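(* Let $m\ge 0$, let $g_m$ be the LeBrun metric on $\mathbb{C}^2$, and let $\alpha>0$ be a real number. Then the metric $\alpha g_m$ is balanced if and only if $m=0$, i.e. if and only if $g_m$ is the flat metric on $\mathbb{C}^2$.
   Context: LeBrun metric. Fix a real number $m\ge 0$. Let $(z_1,z_2)$ be the standard coordinates on $\mathbb{C}^2$. The functions $u,v\ge 0$ on $\mathbb{C}^2$ are implicitly defined by $|z_1|=e^{m(u^2-v^2)}u$, $|z_2|=e^{m(v^2-u^2)}v$. Put $\Phi_m=u^2+v^2+m(u^4+v^4)$. The LeBrun metric $g_m$ is the Kähler metric on $\mathbb{C}^2$ with Kähler form $\omega_m=\frac{i}{2}\partial\bar\partial\Phi_m$. For $m=0$ it is the flat metric, with Kähler form $\omega_0=\frac{i}{2}(dz_1\wedge d\bar z_1+dz_2\wedge d\bar z_2)$. For every $m\geq 0$ it is known that $\omega_m\wedge\omega_m=\omega_0\wedge\omega_0$. Balanced metrics. Let $M$ be an $n$-dimensional complex manifold with a Kähler metric $g$ whose Kähler form is $\omega=\frac{i}{2}\partial\bar\partial\Phi$ for a global strictly plurisubharmonic function $\Phi:M\to\mathbb{R}$. For $\alpha>0$ let $\mathcal{H}_{\alpha\Phi}$ be the Hilbert space of holomorphic functions $f$ on $M$ with $\int_M e^{-\alpha\Phi}|f|^2\frac{\omega^n}{n!}<\infty$, with the corresponding $L^2$ inner product. If $\mathcal{H}_{\alpha\Phi}\ne\{0\}$, let $\{f_j^\alpha\}$ be an orthonormal basis, let $K_{\alpha\Phi}(x,y)=\sum_j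 f_j^\alpha(x)\overline{f_j^\alpha(y)}$ be the reproducing kernel, and put $\epsilon_{\alpha g}(x)=e^{-\alpha\Phi(x)}K_{\alpha\Phi}(x,x)$. (This does not depend on the choice of the orthonormal basis or of the potential.) The metric $\alpha g$ is called balanced if $\epsilon_{\alpha g}$ is a positive constant function. For $\alpha g_m$ one uses $M=\mathbb{C}^2$, $\Phi=\Phi_m$, $\omega=\omega_m$. *)

theory Defs
  imports "HOL-Analysis.Analysis"
begin

type_synonym c2 = "complex \<times> complex"

definition cscale :: "complex \<Rightarrow> c2 \<Rightarrow> c2" where
  "cscale c X = (c * fst X, c * snd X)"

definition e1 :: c2 where "e1 = (1, 0)"
definition e2 :: c2 where "e2 = (0, 1)"

definition dir_deriv :: "c2 \<Rightarrow> (c2 \<Rightarrow> complex) \<Rightarrow> c2 \<Rightarrow> complex" where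
  "dir_deriv X F p = vector_derivative (\<lambda>t. F (p + t *\<^sub>R X)) (at 0)"

(* For X = e_j these are the Wirtinger derivatives d/dz_j and d/d(conj z_j). *)
definition wirt :: "c2 \<Rightarrow> (c2 \<Rightarrow> complex) \<Rightarrow> c2 \<Rightarrow> complex" where
  "wirt X F p = (dir_deriv X F p - \<i> * dir_deriv (cscale \<i> X) F p) / 2"

definition wirt_bar :: "c2 \<Rightarrow> (c2 \<Rightarrow> complex) \<Rightarrow> c2 \<Rightarrow> complex" where
  "wirt_bar X F p = (dir_deriv X F p + \<i> * dir_deriv (cscale \<i> X) F p) / 2"

definition complex_hessian :: "(c2 \<Rightarrow> real) \<Rightarrow> c2 \<Rightarrow> c2 \<Rightarrow> c2 \<Rightarrow> complex" where
  "complex_hessian \<Phi> p X Y = wirt X (wirt_bar Y (\<lambda>q. complex_of_real (\<Phi> q))) p"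

(* (i/2) sum_{j,k} Phi_{j kbar} dz_j \<and> d(conj z_k), evaluated on the real tangent vectors X, Y,
   with the convention (a \<and> b)(X,Y) = a(X) b(Y) - a(Y) b(X). The value is real for C^2 potentials. *)
definition kaehler_form :: "(c2 \<Rightarrow> real) \<Rightarrow> c2 \<Rightarrow> c2 \<Rightarrow> c2 \<Rightarrow> real" where
  "kaehler_form \<Phi> p X Y = Re (\<i> / 2 *
     (complex_hessian \<Phi> p e1 e1 * (fst X * cnj (fst Y) - fst Y * cnj (fst X))
    + complex_hessian \<Phi> p e1 e2 * (fst X * cnj (snd Y) - fst Y * cnj (snd X))
    + complex_hessian \<Phi> p e2 e1 * (snd X * cnj (fst Y) - snd Y * cnj (fst X))
    + complex_hessian \<Phi> p e2 e2 * (snd X * cnj (snd Y) - snd Y * cnj (snd X))))"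

definition kaehler_metric :: "(c2 \<Rightarrow> real) \<Rightarrow> c2 \<Rightarrow> c2 \<Rightarrow> c2 \<Rightarrow> real" where
  "kaehler_metric \<Phi> p X Y = kaehler_form \<Phi> p X (cscale \<i> Y)"

definition flat_metric :: "c2 \<Rightarrow> c2 \<Rightarrow> c2 \<Rightarrow> real" where
  "flat_metric p X Y = X \<bullet> Y"

(* (\<omega> \<and> \<omega>) / 2! evaluated on the oriented real basis e1, i e1, e2, i e2, that is, the density of
   this volume form with respect to Lebesgue measure. *)
definition volume_density :: "(c2 \<Rightarrow> real) \<Rightarrow> c2 \<Rightarrow> real" where
  "volume_density \<Phi> p =
     (let \<omega> = kaehler_form \<Phi> p; f1 = cscale \<i> e1; f2 = cscale \<i> e2
      in \<omega> e1 f1 * \<omega> e2 f2 - \<omega> e1 e2 * \<omega> f1 f2 + \<omega> e1 f2 * \<omega> f1 e2)"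

(* Meant for strictly plurisubharmonic potentials, where the density is positive;
   ennreal would cut off negative values. *)
definition volume_measure :: "(c2 \<Rightarrow> real) \<Rightarrow> c2 measure" where
  "volume_measure \<Phi> = density lborel (\<lambda>p. ennreal (volume_density \<Phi> p))"

definition holomorphic2 :: "(c2 \<Rightarrow> complex) \<Rightarrow> bool" where
  "holomorphic2 f \<longleftrightarrow> (\<forall>p. \<exists>a b. (f has_derivative (\<lambda>h. a * fst h + b * snd h)) (at p))"

definition weighted_space :: "real \<Rightarrow> (c2 \<Rightarrow> real) \<Rightarrow> (c2 \<Rightarrow> complex) set" where
  "weighted_space \<alpha> \<Phi> = {f. holomorphic2 f \<and>
     integrable (volume_measure \<Phi>) (\<lambda>p. exp (- \<alpha> * \<Phi> p) * (cmod (f p))\<^sup>2)}"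

definition weighted_inner ::
    "real \<Rightarrow> (c2 \<Rightarrow> real) \<Rightarrow> (c2 \<Rightarrow> complex) \<Rightarrow> (c2 \<Rightarrow> complex) \<Rightarrow> complex" where
  "weighted_inner \<alpha> \<Phi> f g =
     (LINT p|volume_measure \<Phi>. complex_of_real (exp (- \<alpha> * \<Phi> p)) * (f p * cnj (g p)))"

definition weighted_norm :: "real \<Rightarrow> (c2 \<Rightarrow> real) \<Rightarrow> (c2 \<Rightarrow> complex) \<Rightarrow> real" where
  "weighted_norm \<alpha> \<Phi> f = sqrt (Re (weighted_inner \<alpha> \<Phi> f f))"

(* Orthonormal basis in the Hilbert space sense: orthonormal, with dense linear span. *)
definition orthonormal_basis :: "real \<Rightarrow> (c2 \<Rightarrow> real) \<Rightarrow> (c2 \<Rightarrow> complex) set \<Rightarrow> bool" where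
  "orthonormal_basis \<alpha> \<Phi> B \<longleftrightarrow>
     B \<subseteq> weighted_space \<alpha> \<Phi> \<and>
     (\<forall>f\<in>B. \<forall>g\<in>B. weighted_inner \<alpha> \<Phi> f g = (if f = g then 1 else 0)) \<and>
     (\<forall>h\<in>weighted_space \<alpha> \<Phi>. \<forall>\<epsilon>>0. \<exists>F c. finite F \<and> F \<subseteq> B \<and>
        weighted_norm \<alpha> \<Phi> (\<lambda>p. h p - (\<Sum>f\<in>F. c f * f p)) < \<epsilon>)"

definition weighted_kernel :: "real \<Rightarrow> (c2 \<Rightarrow> real) \<Rightarrow> c2 \<Rightarrow> c2 \<Rightarrow> complex" where
  "weighted_kernel \<alpha> \<Phi> x y =
     (\<Sum>\<^sub>\<infinity>f\<in>(SOME B. orthonormal_basis \<alpha> \<Phi> B). f x * cnj (f y))"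

definition epsilon_fun :: "real \<Rightarrow> (c2 \<Rightarrow> real) \<Rightarrow> c2 \<Rightarrow> real" where
  "epsilon_fun \<alpha> \<Phi> x = exp (- \<alpha> * \<Phi> x) * Re (weighted_kernel \<alpha> \<Phi> x x)"

(* "alpha g is balanced", where g is the Kaehler metric on C^2 with Kaehler form
   (i/2) d dbar Phi; it is the volume form of g, not of alpha g, that enters the inner product. *)
definition balanced :: "real \<Rightarrow> (c2 \<Rightarrow> real) \<Rightarrow> bool" where
  "balanced \<alpha> \<Phi> \<longleftrightarrow> weighted_space \<alpha> \<Phi> \<noteq> {\<lambda>_. 0} \<and>
     (\<exists>c>0. \<forall>x. epsilon_fun \<alpha> \<Phi> x = c)"

definition lebrun_uv :: "real \<Rightarrow> c2 \<Rightarrow> real \<times> real" where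
  "lebrun_uv m z = (THE (u, v). 0 \<le> u \<and> 0 \<le> v \<and>
     cmod (fst z) = exp (m * (u\<^sup>2 - v\<^sup>2)) * u \<and>
     cmod (snd z) = exp (m * (v\<^sup>2 - u\<^sup>2)) * v)"

definition lebrun_potential :: "real \<Rightarrow> c2 \<Rightarrow> real" where
  "lebrun_potential m z = (let (u, v) = lebrun_uv m z in u\<^sup>2 + v\<^sup>2 + m * (u ^ 4 + v ^ 4))"

definition lebrun_metric :: "real \<Rightarrow> c2 \<Rightarrow> c2 \<Rightarrow> c2 \<Rightarrow> real" where
  "lebrun_metric m = kaehler_metric (lebrun_potential m)"

end

theory Submission
  imports Defs "HOL-Complex_Analysis.Complex_Analysis" "HOL-Real_Asymp.Real_Asymp"
begin

text \<open>
  Write \<open>s = \<bar>z\<^sub>1\<bar>\<^sup>2\<close>, \<open>t = \<bar>z\<^sub>2\<bar>\<^sup>2\<close> and \<open>D = u\<^sup>2 - v\<^sup>2\<close>. The equations that define \<open>u\<close> and \<open>v\<close> say that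
  \<open>D = s e\<^sup>-\<^sup>2\<^sup>m\<^sup>D - t e\<^sup>2\<^sup>m\<^sup>D\<close>. The right-hand side decreases in \<open>D\<close>, so \<open>D\<close> is a well defined function of
  \<open>(s, t)\<close>, and unlike \<open>u\<close> and \<open>v\<close> it is smooth up to the axes. In terms of \<open>D\<close> the potential is
  \<open>\<Phi> = s e\<^sup>-\<^sup>2\<^sup>m\<^sup>D + t e\<^sup>2\<^sup>m\<^sup>D + m D\<^sup>2 + 2 m s t\<close>, which is stationary in \<open>D\<close>; implicit differentiation gives
  the complex Hessian everywhere, and its determinant is 1. So the volume measure is Lebesgue measure
  (\<open>volume_measure_lebrun\<close>). At \<open>(z\<^sub>1, 0)\<close> the first Hessian entry is \<open>e\<^sup>-\<^sup>2\<^sup>m\<^sup>U / (1 + 2 m U)\<close> with \<open>U = u\<^sup>2\<close>,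
  which differs from 1 when \<open>m > 0\<close> and \<open>U > 0\<close> (\<open>lebrun_metric_flat_iff\<close>).

  The potential is invariant under the torus that rotates the two coordinates. Hence monomials are
  orthogonal, and Parseval's identity on each torus \<open>\<bar>z\<^sub>1\<bar> = r\<^sub>1\<close>, \<open>\<bar>z\<^sub>2\<bar> = r\<^sub>2\<close> shows that Taylor polynomials
  converge in the weighted norm; the normalised monomials of finite norm are an orthonormal basis
  (\<open>ex_orthonormal_basis\<close>). So the kernel really is the sum over an orthonormal basis.

  For \<open>m = 0\<close> the weight is Gaussian. The function \<open>z \<mapsto> C\<^sup>-\<^sup>1 e\<^bsup>\<alpha>\<langle>z,x\<rangle>\<^esup>\<close>, where \<open>C\<close> is the total mass of
  \<open>e\<^bsup>-\<alpha>\<bar>z\<bar>\<^sup>2\<^esup>\<close>, reproduces the value at \<open>x\<close>: after a translation by \<open>x\<close> this is the mean value property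
  (\<open>gkernel_reproducing\<close>). By Parseval in the weighted space, every orthonormal basis yields the kernel
  \<open>C\<^sup>-\<^sup>1 e\<^bsup>\<alpha>\<bar>x\<bar>\<^sup>2\<^esup>\<close> on the diagonal, and \<open>\<epsilon> = C\<^sup>-\<^sup>1\<close>.

  For \<open>m > 0\<close> suppose that \<open>\<epsilon> = c\<close> is constant, that is, \<open>c e\<^bsup>\<alpha>\<Phi>\<^esup> = \<Sum> \<bar>f\<bar>\<^sup>2\<close> over an orthonormal basis of entire
  functions. On the axis \<open>z\<^sub>2 = 0\<close> we average over rotations of \<open>z\<^sub>1\<close>. This turns the right-hand side into
  a power series in \<open>s\<close> that converges for every \<open>s \<ge> 0\<close>, so \<open>c e\<^bsup>\<alpha>\<Phi>\<^esup>\<close> is the restriction of an entire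
  function \<open>G(s)\<close> (\<open>kernel_axis_entire\<close>). But on the axis \<open>\<Phi> = U + m U\<^sup>2\<close> with \<open>s = U e\<^sup>2\<^sup>m\<^sup>U\<close>. The identity
  \<open>G(U e\<^sup>2\<^sup>m\<^sup>U) = c e\<^bsup>\<alpha>(U + m U\<^sup>2)\<^esup>\<close> extends to all complex \<open>U\<close>, and it fails at the critical point
  \<open>U = -1/(2m)\<close> of \<open>U e\<^sup>2\<^sup>m\<^sup>U\<close> (\<open>lebrun_axis_not_entire\<close>).
\<close>

section \<open>The LeBrun potential in terms of \<open>u\<^sup>2 - v\<^sup>2\<close>\<close>

text \<open>The difference \<open>u\<^sup>2 - v\<^sup>2\<close> as a function of \<open>s = \<bar>z\<^sub>1\<bar>\<^sup>2\<close> and \<open>t = \<bar>z\<^sub>2\<bar>\<^sup>2\<close>: the defining equations give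
  \<open>u\<^sup>2 = s e\<^sup>-\<^sup>2\<^sup>m\<^sup>D\<close> and \<open>v\<^sup>2 = t e\<^sup>2\<^sup>m\<^sup>D\<close>.\<close>

definition gap :: "real \<Rightarrow> real \<Rightarrow> real \<Rightarrow> real" where
  "gap m s t = (THE D. D = s * exp (- 2 * m * D) - t * exp (2 * m * D))"

lemma gap_unique:
  fixes m s t D D' :: real
  assumes "m \<ge> 0" "s \<ge> 0" "t \<ge> 0"
    and D: "D = s * exp (- 2 * m * D) - t * exp (2 * m * D)"
    and D': "D' = s * exp (- 2 * m * D') - t * exp (2 * m * D')"
  shows "D = D'"
proof -
  have *: "y \<le> x" if "x < y" "x = s * exp (- 2 * m * x) - t * exp (2 * m * x)"
    "y = s * exp (- 2 * m * y) - t * exp (2 * m * y)" for x y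
  proof -
    have "2 * m * x \<le> 2 * m * y" using that(1) assms(1) by (simp add: mult_left_mono)
    then have "exp (- 2 * m * y) \<le> exp (- 2 * m * x)" "exp (2 * m * x) \<le> exp (2 * m * y)"
      by simp_all
    then have "s * exp (- 2 * m * y) \<le> s * exp (- 2 * m * x)" "t * exp (2 * m * x) \<le> t * exp (2 * m * y)"
      using assms(2,3) by (simp_all only: mult_left_mono)
    then show ?thesis using that(2,3) by linarith
  qed
  show ?thesis using *[of D D'] *[of D' D] D D' by (cases D D' rule: linorder_cases) auto
qed

lemma gap_exists:
  fixes m s t :: real
  assumes "m \<ge> 0" "s \<ge> 0" "t \<ge> 0"
  shows "\<exists>D. D = s * exp (- 2 * m * D) - t * exp (2 * m * D)"
proof -
  let ?G = "\<lambda>D. D - s * exp (- 2 * m * D) + t * exp (2 * m * D)"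
  have "?G (-t) \<le> 0"
  proof -
    have "t * exp (2 * m * -t) \<le> t * 1" using assms by (intro mult_left_mono) auto
    moreover have "0 \<le> s * exp (- 2 * m * -t)" using assms by simp
    ultimately show ?thesis by linarith
  qed
  moreover have "0 \<le> ?G s"
  proof -
    have "s * exp (- 2 * m * s) \<le> s * 1" using assms by (intro mult_left_mono) auto
    moreover have "0 \<le> t * exp (2 * m * s)" using assms by simp
    ultimately show ?thesis by linarith
  qed
  ultimately have "\<exists>x\<ge>-t. x \<le> s \<and> ?G x = 0"
    using assms by (intro IVT) (auto intro!: continuous_intros)
  then obtain x where "?G x = 0" by blast
  then have "x = s * exp (- 2 * m * x) - t * exp (2 * m * x)" by linarith
  then show ?thesis by blast
qed

lemma gap_eq:
  assumes "m \<ge> 0" "s \<ge> 0" "t \<ge> 0"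
  shows "gap m s t = s * exp (- 2 * m * gap m s t) - t * exp (2 * m * gap m s t)"
  unfolding gap_def using gap_exists[OF assms] gap_unique[OF assms]
  by (rule_tac theI') blast

lemma gap_eqI:
  assumes "m \<ge> 0" "s \<ge> 0" "t \<ge> 0" "D = s * exp (- 2 * m * D) - t * exp (2 * m * D)"
  shows "gap m s t = D"
  using gap_unique[OF assms(1-3) gap_eq[OF assms(1-3)] assms(4)] .

text \<open>The right-hand side of the equation for \<open>D\<close> decreases in \<open>D\<close>, so the root moves by at most the
  change of the right-hand side at the old root. This estimate gives continuity.\<close>

lemma gap_abs_diff_le:
  fixes s t s' t' :: real
  assumes m: "m \<ge> 0" and st: "s \<ge> 0" "t \<ge> 0" "s' \<ge> 0" "t' \<ge> 0"
  defines "D \<equiv> gap m s t"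
  shows "\<bar>gap m s' t' - D\<bar> \<le> \<bar>(s' - s) * exp (- 2 * m * D) - (t' - t) * exp (2 * m * D)\<bar>"
proof -
  let ?D' = "gap m s' t'"
  have D: "D = s * exp (- 2 * m * D) - t * exp (2 * m * D)"
    unfolding D_def by (rule gap_eq) (use m st in auto)
  have D': "?D' = s' * exp (- 2 * m * ?D') - t' * exp (2 * m * ?D')"
    by (rule gap_eq) (use m st in auto)
  have mono: "s' * exp (- 2 * m * y) - t' * exp (2 * m * y) \<le> s' * exp (- 2 * m * x) - t' * exp (2 * m * x)"
    if "x \<le> y" for x y
  proof -
    have "2 * m * x \<le> 2 * m * y" using that m by (simp add: mult_left_mono)
    then have "exp (- 2 * m * y) \<le> exp (- 2 * m * x)" "exp (2 * m * x) \<le> exp (2 * m * y)"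
      by simp_all
    then show ?thesis using st(3,4) by (intro diff_mono mult_left_mono)
  qed
  have R: "(s' - s) * exp (- 2 * m * D) - (t' - t) * exp (2 * m * D) =
    s' * exp (- 2 * m * D) - t' * exp (2 * m * D) - D"
    by (subst (3) D) (simp add: algebra_simps)
  show ?thesis
    unfolding R using mono[of D ?D'] mono[of ?D' D] D' by linarith
qed

text \<open>Implicit differentiation along a curve. Replacing the differences of the two exponentials by
  Caratheodory's slope functions turns the equation into \<open>(D - D\<^sub>0) F = R\<close>, where \<open>F \<ge> 1\<close> because the
  slopes have the right signs; dividing by \<open>F\<close> gives the difference quotient of \<open>D\<close>.\<close>

lemma has_derivative_gap:
  fixes s t :: "real \<Rightarrow> real"
  assumes m: "m \<ge> 0" and s: "\<And>x. s x \<ge> 0" and t: "\<And>x. t x \<ge> 0"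
    and ds: "(s has_real_derivative s') (at x)" and dt: "(t has_real_derivative t') (at x)"
  defines "D \<equiv> gap m (s x) (t x)"
  shows "((\<lambda>x. gap m (s x) (t x)) has_real_derivative
    (exp (- 2 * m * D) * s' - exp (2 * m * D) * t') /
      (1 + 2 * m * (s x * exp (- 2 * m * D) + t x * exp (2 * m * D)))) (at x)"
proof -
  let ?g = "\<lambda>x. gap m (s x) (t x)"
  have "((\<lambda>y. exp (- 2 * m * y)) has_real_derivative - 2 * m * exp (- 2 * m * D)) (at D)"
    by (auto intro!: derivative_eq_intros)
  then obtain E1 where E1: "\<And>y. exp (- 2 * m * y) - exp (- 2 * m * D) = E1 y * (y - D)"
    "isCont E1 D" "E1 D = - 2 * m * exp (- 2 * m * D)"
    unfolding CARAT_DERIV by auto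
  have "((\<lambda>y. exp (2 * m * y)) has_real_derivative 2 * m * exp (2 * m * D)) (at D)"
    by (auto intro!: derivative_eq_intros)
  then obtain E2 where E2: "\<And>y. exp (2 * m * y) - exp (2 * m * D) = E2 y * (y - D)"
    "isCont E2 D" "E2 D = 2 * m * exp (2 * m * D)"
    unfolding CARAT_DERIV by auto
  have E1_le: "E1 y \<le> 0" for y
  proof (cases y D rule: linorder_cases)
    case equal then show ?thesis using E1(3) m by simp
  next
    case less
    have "exp (- 2 * m * D) \<le> exp (- 2 * m * y)" using less m by (simp add: mult_left_mono)
    then have "E1 y * (y - D) \<ge> 0" unfolding E1(1)[symmetric] by simp
    then show ?thesis using less by (simp add: zero_le_mult_iff)
  next
    case greater
    have "exp (- 2 * m * y) \<le> exp (- 2 * m * D)" using greater m by (simp add: mult_left_mono)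
    then have "E1 y * (y - D) \<le> 0" unfolding E1(1)[symmetric] by simp
    then show ?thesis using greater by (simp add: mult_le_0_iff)
  qed
  have E2_ge: "E2 y \<ge> 0" for y
  proof (cases y D rule: linorder_cases)
    case equal then show ?thesis using E2(3) m by simp
  next
    case less
    have "exp (2 * m * y) \<le> exp (2 * m * D)" using less m by (simp add: mult_left_mono)
    then have "E2 y * (y - D) \<le> 0" unfolding E2(1)[symmetric] by simp
    then show ?thesis using less by (simp add: mult_le_0_iff)
  next
    case greater
    have "exp (2 * m * D) \<le> exp (2 * m * y)" using greater m by (simp add: mult_left_mono)
    then have "E2 y * (y - D) \<ge> 0" unfolding E2(1)[symmetric] by simp
    then show ?thesis using greater by (simp add: zero_le_mult_iff)
  qed
  \<comment> \<open>The equations at \<open>h\<close> and at \<open>x\<close> are subtracted and solved for the increment of \<open>D\<close>.\<close>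
  define F where "F h = 1 - s h * E1 (?g h) + t h * E2 (?g h)" for h
  have F1: "F h \<ge> 1" for h
    using mult_nonneg_nonpos[OF s[of h] E1_le[of "?g h"]] mult_nonneg_nonneg[OF t[of h] E2_ge[of "?g h"]]
    unfolding F_def by linarith
  define R where "R h = (s h - s x) * exp (- 2 * m * D) - (t h - t x) * exp (2 * m * D)" for h
  have FR: "(?g h - D) * F h = R h" for h
  proof -
    have "?g h - D = s h * exp (- 2 * m * ?g h) - t h * exp (2 * m * ?g h)
       - (s x * exp (- 2 * m * D) - t x * exp (2 * m * D))"
      using gap_eq[OF m s t, of h h] gap_eq[OF m s t, of x x] unfolding D_def by linarith
    also have "\<dots> = s h * (exp (- 2 * m * ?g h) - exp (- 2 * m * D))
        - t h * (exp (2 * m * ?g h) - exp (2 * m * D)) + R h"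
      unfolding R_def by (simp add: algebra_simps)
    also have "\<dots> = s h * (E1 (?g h) * (?g h - D)) - t h * (E2 (?g h) * (?g h - D)) + R h"
      unfolding E1(1) E2(1) ..
    finally show ?thesis unfolding F_def by (simp add: algebra_simps)
  qed
  have dR: "(R has_real_derivative exp (- 2 * m * D) * s' - exp (2 * m * D) * t') (at x)"
    unfolding R_def by (auto intro!: derivative_eq_intros ds dt)
  then have "(R \<longlongrightarrow> R x) (at x)" using DERIV_isCont isCont_def by blast
  then have R0: "(R \<longlongrightarrow> 0) (at x)" by (simp add: R_def)
  have g0: "(?g \<longlongrightarrow> D) (at x)"
  proof -
    have "\<bar>?g h - D\<bar> \<le> \<bar>R h\<bar>" for h
      unfolding D_def R_def using gap_abs_diff_le[OF m s[of x] t[of x] s[of h] t[of h]] .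
    then have "((\<lambda>h. ?g h - D) \<longlongrightarrow> 0) (at x)"
      using R0 by (intro Lim_null_comparison[OF _ tendsto_rabs_zero[OF R0]] always_eventually) auto
    then show ?thesis by (simp add: LIM_zero_iff)
  qed
  have st: "(s \<longlongrightarrow> s x) (at x)" "(t \<longlongrightarrow> t x) (at x)"
    using DERIV_isCont[OF ds] DERIV_isCont[OF dt] by (auto simp: isCont_def)
  have Fl: "(F \<longlongrightarrow> 1 + 2 * m * (s x * exp (- 2 * m * D) + t x * exp (2 * m * D))) (at x)"
  proof -
    have "(F \<longlongrightarrow> 1 - s x * E1 D + t x * E2 D) (at x)"
      unfolding F_def
      by (intro tendsto_intros st isCont_tendsto_compose[OF E1(2) g0] isCont_tendsto_compose[OF E2(2) g0])
    then show ?thesis unfolding E1(3) E2(3) by (simp add: algebra_simps)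
  qed
  have Rl: "((\<lambda>h. R h / (h - x)) \<longlongrightarrow> exp (- 2 * m * D) * s' - exp (2 * m * D) * t') (at x)"
    using dR unfolding has_field_derivative_iff by (simp add: R_def)
  have "((\<lambda>h. R h / (h - x) / F h) \<longlongrightarrow> (exp (- 2 * m * D) * s' - exp (2 * m * D) * t') /
      (1 + 2 * m * (s x * exp (- 2 * m * D) + t x * exp (2 * m * D)))) (at x)"
  proof (intro tendsto_divide Rl Fl)
    have "0 \<le> 2 * m * (s x * exp (- 2 * m * D) + t x * exp (2 * m * D))" using m s t by simp
    then show "1 + 2 * m * (s x * exp (- 2 * m * D) + t x * exp (2 * m * D)) \<noteq> 0" by linarith
  qed
  moreover have "R h / (h - x) / F h = (?g h - ?g x) / (h - x)" for h
    using F1[of h] unfolding FR[symmetric] D_def by simp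
  ultimately show ?thesis
    unfolding has_field_derivative_iff by simp
qed

lemma lebrun_uv_eq:
  assumes "m \<ge> 0"
  defines "D \<equiv> \<lambda>z. gap m ((cmod (fst z))\<^sup>2) ((cmod (snd z))\<^sup>2)"
  shows "lebrun_uv m z = (exp (- m * D z) * cmod (fst z), exp (m * D z) * cmod (snd z))"
  unfolding lebrun_uv_def
proof (rule the_equality, goal_cases)
  case 1
  let ?u = "exp (- m * D z) * cmod (fst z)" and ?v = "exp (m * D z) * cmod (snd z)"
  have "D z = (cmod (fst z))\<^sup>2 * exp (- 2 * m * D z) - (cmod (snd z))\<^sup>2 * exp (2 * m * D z)"
    unfolding D_def by (rule gap_eq) (use assms in auto)
  then have "?u\<^sup>2 - ?v\<^sup>2 = D z"
    by (simp add: power_mult_distrib flip: exp_of_nat_mult) (simp add: mult_ac)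
  moreover have "?v\<^sup>2 - ?u\<^sup>2 = - D z" using calculation by simp
  ultimately show ?case
    by (simp add: exp_minus field_simps)
next
  case (2 uv)
  obtain u v where uv: "uv = (u, v)" by force
  have u: "0 \<le> u" "0 \<le> v" "cmod (fst z) = exp (m * (u\<^sup>2 - v\<^sup>2)) * u" "cmod (snd z) = exp (m * (v\<^sup>2 - u\<^sup>2)) * v"
    using 2 unfolding uv by auto
  have a: "(cmod (fst z))\<^sup>2 * exp (- 2 * m * (u\<^sup>2 - v\<^sup>2)) = u\<^sup>2"
    unfolding u(3) by (simp add: power_mult_distrib mult_ac flip: exp_of_nat_mult exp_add)
  have b: "(cmod (snd z))\<^sup>2 * exp (2 * m * (u\<^sup>2 - v\<^sup>2)) = v\<^sup>2"
  proof -
    have "2 * m * (u\<^sup>2 - v\<^sup>2) = - (2 * (m * (v\<^sup>2 - u\<^sup>2)))" by (simp add: algebra_simps)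
    then show ?thesis
      unfolding u(4) by (simp add: power_mult_distrib mult_ac flip: exp_of_nat_mult exp_add)
  qed
  have D: "D z = u\<^sup>2 - v\<^sup>2"
    unfolding D_def by (rule gap_eqI) (use assms in \<open>auto simp only: a b zero_le_power2\<close>)
  have "m * (v\<^sup>2 - u\<^sup>2) = - (m * (u\<^sup>2 - v\<^sup>2))" by (simp add: algebra_simps)
  then show ?case unfolding uv D u(3,4) by (simp add: exp_minus)
qed

abbreviation sq1 :: "c2 \<Rightarrow> real" where "sq1 z \<equiv> (cmod (fst z))\<^sup>2"
abbreviation sq2 :: "c2 \<Rightarrow> real" where "sq2 z \<equiv> (cmod (snd z))\<^sup>2"
abbreviation gap2 :: "real \<Rightarrow> c2 \<Rightarrow> real" where "gap2 m z \<equiv> gap m (sq1 z) (sq2 z)"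

lemma continuous_on_gap2:
  assumes "m \<ge> 0"
  shows "continuous_on A (gap2 m)"
proof (intro continuous_at_imp_continuous_on ballI)
  fix p
  let ?D = "gap2 m p"
  let ?R = "\<lambda>q. (sq1 q - sq1 p) * exp (- 2 * m * ?D) - (sq2 q - sq2 p) * exp (2 * m * ?D)"
  have "isCont ?R p" by (intro continuous_intros)
  then have "(?R \<longlongrightarrow> 0) (at p)" unfolding isCont_def by simp
  then have "((\<lambda>q. \<bar>?R q\<bar>) \<longlongrightarrow> 0) (at p)" by (rule tendsto_rabs_zero)
  moreover have "\<forall>\<^sub>F q in at p. norm (gap2 m q - ?D) \<le> \<bar>?R q\<bar>"
    unfolding real_norm_def by (intro always_eventually allI gap_abs_diff_le assms) auto
  ultimately have "((\<lambda>q. gap2 m q - ?D) \<longlongrightarrow> 0) (at p)"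
    by (rule Lim_null_comparison[rotated])
  then show "isCont (gap2 m) p" unfolding isCont_def by (simp add: LIM_zero_iff)
qed

text \<open>Both \<open>u\<^sup>4 + v\<^sup>4 = D\<^sup>2 + 2 u\<^sup>2 v\<^sup>2\<close> and \<open>u\<^sup>2 v\<^sup>2 = s t\<close>, since the exponential factors cancel in the product.\<close>

lemma lebrun_potential_eq:
  assumes "m \<ge> 0"
  shows "lebrun_potential m z = sq1 z * exp (- 2 * m * gap2 m z) + sq2 z * exp (2 * m * gap2 m z)
    + m * (gap2 m z)\<^sup>2 + 2 * m * sq1 z * sq2 z"
proof -
  define U V where "U = sq1 z * exp (- 2 * m * gap2 m z)" and "V = sq2 z * exp (2 * m * gap2 m z)"
  have D: "gap2 m z = U - V"
    unfolding U_def V_def by (rule gap_eq) (use assms in auto)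
  have UV: "sq1 z * sq2 z = U * V" unfolding U_def V_def by (simp flip: exp_add add: algebra_simps exp_minus)
  have u2: "(exp (- m * gap2 m z) * cmod (fst z))\<^sup>2 = U" 
    unfolding U_def by (simp add: power_mult_distrib mult_ac flip: exp_of_nat_mult)
  have v2: "(exp (m * gap2 m z) * cmod (snd z))\<^sup>2 = V" 
    unfolding V_def by (simp add: power_mult_distrib mult_ac flip: exp_of_nat_mult)
  have 4: "x ^ 4 = (x\<^sup>2)\<^sup>2" for x :: real by simp
  have "lebrun_potential m z = U + V + m * (U\<^sup>2 + V\<^sup>2)"
    unfolding lebrun_potential_def lebrun_uv_eq[OF assms] Let_def prod.case 4 u2 v2 ..
  also have "\<dots> = U + V + m * (U - V)\<^sup>2 + 2 * m * (U * V)" by (simp add: power2_eq_square algebra_simps)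
  also have "\<dots> = U + V + m * (U - V)\<^sup>2 + 2 * m * sq1 z * sq2 z" using UV by simp
  finally show ?thesis using D unfolding U_def V_def by simp
qed

section \<open>Complex Hessian, volume and flatness of the LeBrun metric\<close>

text \<open>For a function of \<open>s = \<bar>z\<^sub>1\<bar>\<^sup>2\<close> and \<open>t = \<bar>z\<^sub>2\<bar>\<^sup>2\<close> with partial derivatives \<open>A\<close> and \<open>B\<close> at \<open>p\<close>, this is the chain
  rule along lines. The derivatives that enter the complex Hessian are taken along lines only.\<close>

definition radial_deriv :: "(c2 \<Rightarrow> real) \<Rightarrow> c2 \<Rightarrow> real \<Rightarrow> real \<Rightarrow> bool" where
  "radial_deriv R p A B \<longleftrightarrow> (\<forall>X. ((\<lambda>\<tau>. R (p + \<tau> *\<^sub>R X)) has_real_derivative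
     A * (2 * Re (fst p * cnj (fst X))) + B * (2 * Re (snd p * cnj (snd X)))) (at 0))"

lemma radial_derivD: "radial_deriv R p A B \<Longrightarrow> ((\<lambda>\<tau>. R (p + \<tau> *\<^sub>R X)) has_real_derivative
     A * (2 * Re (fst p * cnj (fst X))) + B * (2 * Re (snd p * cnj (snd X)))) (at 0)"
  unfolding radial_deriv_def by blast

lemma radial_deriv_cong: "radial_deriv R p A B \<Longrightarrow> A = A' \<Longrightarrow> B = B' \<Longrightarrow> radial_deriv R p A' B'"
  by simp

lemma DERIV_cmod_sq_line:
  "((\<lambda>\<tau>. (cmod (a + of_real \<tau> * b))\<^sup>2) has_real_derivative 2 * Re (a * cnj b)) (at 0)"
  unfolding cmod_power2 by (auto intro!: derivative_eq_intros)

lemma radial_deriv_sq1: "radial_deriv sq1 p 1 0" and radial_deriv_sq2: "radial_deriv sq2 p 0 1"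
  unfolding radial_deriv_def using DERIV_cmod_sq_line by (auto simp: scaleR_conv_of_real)

lemma radial_deriv_const: "radial_deriv (\<lambda>_. c) p 0 0"
  unfolding radial_deriv_def by auto

lemma radial_deriv_add:
  "radial_deriv R p A B \<Longrightarrow> radial_deriv S p A' B' \<Longrightarrow> radial_deriv (\<lambda>q. R q + S q) p (A + A') (B + B')"
  unfolding radial_deriv_def by (auto intro!: derivative_eq_intros simp: algebra_simps)

lemma radial_deriv_mult:
  assumes "radial_deriv R p A B" "radial_deriv S p A' B'"
  shows "radial_deriv (\<lambda>q. R q * S q) p (A * S p + R p * A') (B * S p + R p * B')"
  unfolding radial_deriv_def
proof
  fix X
  from DERIV_mult[OF assms[THEN radial_derivD]] show "((\<lambda>\<tau>. R (p + \<tau> *\<^sub>R X) * S (p + \<tau> *\<^sub>R X)) has_real_derivative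
     (A * S p + R p * A') * (2 * Re (fst p * cnj (fst X))) +
     (B * S p + R p * B') * (2 * Re (snd p * cnj (snd X)))) (at 0)"
    by (rule DERIV_cong) (simp add: algebra_simps)
qed

lemma radial_deriv_exp:
  assumes "radial_deriv R p A B"
  shows "radial_deriv (\<lambda>q. exp (R q)) p (exp (R p) * A) (exp (R p) * B)"
  unfolding radial_deriv_def
proof
  fix X
  from DERIV_fun_exp[OF radial_derivD[OF assms]] show "((\<lambda>\<tau>. exp (R (p + \<tau> *\<^sub>R X))) has_real_derivative
     exp (R p) * A * (2 * Re (fst p * cnj (fst X))) +
     exp (R p) * B * (2 * Re (snd p * cnj (snd X)))) (at 0)"
    by (rule DERIV_cong) (simp add: algebra_simps)
qed

lemma dir_deriv_radial:
  assumes "radial_deriv R p A B" "\<And>a X. L (p + a *\<^sub>R X) = L p + of_real a * L X"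
  shows "dir_deriv X (\<lambda>q. L q * of_real (R q)) p = L X * of_real (R p) +
    L p * of_real (A * (2 * Re (fst p * cnj (fst X))) + B * (2 * Re (snd p * cnj (snd X))))"
proof -
  from radial_derivD[OF assms(1)] have "((\<lambda>\<tau>. R (p + \<tau> *\<^sub>R X)) has_real_derivative
     A * (2 * Re (fst p * cnj (fst X))) + B * (2 * Re (snd p * cnj (snd X)))) (at 0)"
    (is "(?r has_real_derivative ?d) _") .
  then have r: "((\<lambda>\<tau>. complex_of_real (?r \<tau>)) has_vector_derivative of_real ?d) (at 0)"
    by (rule has_vector_derivative_of_real)
  have l: "((\<lambda>\<tau>. L (p + \<tau> *\<^sub>R X)) has_vector_derivative L X) (at 0)"
    unfolding assms(2) by (auto intro!: derivative_eq_intros)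
  have "((\<lambda>\<tau>. L (p + \<tau> *\<^sub>R X) * of_real (?r \<tau>)) has_vector_derivative
    L p * of_real ?d + L X * of_real (R p)) (at 0)"
    using has_vector_derivative_mult[OF l r] by simp
  then show ?thesis unfolding dir_deriv_def by (simp add: vector_derivative_at algebra_simps)
qed

lemma wirt_bar_radial:
  assumes "radial_deriv R p A B"
  shows "wirt_bar e1 (\<lambda>q. of_real (R q)) p = fst p * of_real A"
    and "wirt_bar e2 (\<lambda>q. of_real (R q)) p = snd p * of_real B"
proof -
  have d: "dir_deriv X (\<lambda>q. of_real (R q)) p =
      of_real (A * (2 * Re (fst p * cnj (fst X))) + B * (2 * Re (snd p * cnj (snd X))))" for X
  proof -
    from radial_derivD[OF assms(1)] have "((\<lambda>\<tau>. R (p + \<tau> *\<^sub>R X)) has_real_derivative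
       A * (2 * Re (fst p * cnj (fst X))) + B * (2 * Re (snd p * cnj (snd X)))) (at 0)"
      (is "(?r has_real_derivative ?d) _") .
    then have r: "((\<lambda>\<tau>. complex_of_real (?r \<tau>)) has_vector_derivative of_real ?d) (at 0)"
      by (rule has_vector_derivative_of_real)
    then show ?thesis unfolding dir_deriv_def by (simp only: vector_derivative_at)
  qed
  show "wirt_bar e1 (\<lambda>q. of_real (R q)) p = fst p * of_real A"
    "wirt_bar e2 (\<lambda>q. of_real (R q)) p = snd p * of_real B"
    unfolding wirt_bar_def d by (auto simp: e1_def e2_def cscale_def complex_eq_iff)
qed

lemma wirt_radial:
  assumes "radial_deriv R p A B"
  shows "wirt e1 (\<lambda>q. fst q * of_real (R q)) p = of_real (R p + sq1 p * A)"
    and "wirt e2 (\<lambda>q. fst q * of_real (R q)) p = fst p * cnj (snd p) * of_real B"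
    and "wirt e1 (\<lambda>q. snd q * of_real (R q)) p = snd p * cnj (fst p) * of_real A"
    and "wirt e2 (\<lambda>q. snd q * of_real (R q)) p = of_real (R p + sq2 p * B)"
proof -
  have f: "fst (p + a *\<^sub>R X) = fst p + of_real a * fst X" "snd (p + a *\<^sub>R X) = snd p + of_real a * snd X"
    for p a and X :: c2
    by (simp_all add: scaleR_conv_of_real)
  note d = dir_deriv_radial[where L = fst, OF assms f(1)] dir_deriv_radial[where L = snd, OF assms f(2)]
  show "wirt e1 (\<lambda>q. fst q * of_real (R q)) p = of_real (R p + sq1 p * A)"
    "wirt e2 (\<lambda>q. fst q * of_real (R q)) p = fst p * cnj (snd p) * of_real B"
    "wirt e1 (\<lambda>q. snd q * of_real (R q)) p = snd p * cnj (fst p) * of_real A"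
    "wirt e2 (\<lambda>q. snd q * of_real (R q)) p = of_real (R p + sq2 p * B)"
    unfolding wirt_def d cmod_power2
    by (auto simp: e1_def e2_def cscale_def complex_eq_iff power2_eq_square field_simps)
qed

text \<open>The factor \<open>1 + 2m(u\<^sup>2 + v\<^sup>2)\<close>, the derivative in \<open>D\<close> of the equation for \<open>D\<close>.\<close>

definition quot :: "real \<Rightarrow> c2 \<Rightarrow> real" where
  "quot m p = 1 + 2 * m * (sq1 p * exp (- 2 * m * gap2 m p) + sq2 p * exp (2 * m * gap2 m p))"

lemma quot_ge_1: "m \<ge> 0 \<Longrightarrow> quot m p \<ge> 1"
  unfolding quot_def by simp

lemma radial_deriv_gap:
  assumes "m \<ge> 0"
  shows "radial_deriv (gap2 m) p (exp (- 2 * m * gap2 m p) / quot m p) (- exp (2 * m * gap2 m p) / quot m p)"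
  unfolding radial_deriv_def
proof
  fix X
  let ?s = "\<lambda>\<tau>. sq1 (p + \<tau> *\<^sub>R X)" and ?t = "\<lambda>\<tau>. sq2 (p + \<tau> *\<^sub>R X)"
  have "(?s has_real_derivative 2 * Re (fst p * cnj (fst X))) (at 0)"
    "(?t has_real_derivative 2 * Re (snd p * cnj (snd X))) (at 0)"
    using DERIV_cmod_sq_line by (auto simp: scaleR_conv_of_real)
  from has_derivative_gap[OF assms _ _ this]
  show "((\<lambda>\<tau>. gap m (?s \<tau>) (?t \<tau>)) has_real_derivative
    exp (- 2 * m * gap2 m p) / quot m p * (2 * Re (fst p * cnj (fst X))) +
    (- exp (2 * m * gap2 m p) / quot m p) * (2 * Re (snd p * cnj (snd X)))) (at 0)"
    by (rule DERIV_cong[OF _ ]) (simp_all add: quot_def diff_divide_distrib)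
qed

text \<open>The terms with a derivative of \<open>D\<close> add up to a multiple of the equation for \<open>D\<close> and vanish: the
  potential is stationary in \<open>D\<close>.\<close>

lemma radial_deriv_lebrun_potential:
  assumes "m \<ge> 0"
  shows "radial_deriv (lebrun_potential m) p
    (exp (- 2 * m * gap2 m p) + 2 * m * sq2 p) (exp (2 * m * gap2 m p) + 2 * m * sq1 p)"
proof -
  let ?D = "gap2 m p"
  have D: "?D = sq1 p * exp (- 2 * m * ?D) - sq2 p * exp (2 * m * ?D)"
    by (rule gap_eq) (use assms in auto)
  note g = radial_deriv_gap[OF assms, of p]
  note e = radial_deriv_exp[OF radial_deriv_mult[OF radial_deriv_const[of "- 2 * m"] g]]
     radial_deriv_exp[OF radial_deriv_mult[OF radial_deriv_const[of "2 * m"] g]]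
  note a = radial_deriv_mult[OF radial_deriv_sq1 e(1)] and b = radial_deriv_mult[OF radial_deriv_sq2 e(2)]
  note c = radial_deriv_mult[OF radial_deriv_const[of m] radial_deriv_mult[OF g g]]
  note d = radial_deriv_mult[OF radial_deriv_mult[OF radial_deriv_const[of "2 * m"] radial_deriv_sq1] radial_deriv_sq2]
  note all = radial_deriv_add[OF radial_deriv_add[OF radial_deriv_add[OF a b] c] d]
  have eq: "lebrun_potential m = (\<lambda>z. sq1 z * exp (- 2 * m * gap2 m z) + sq2 z * exp (2 * m * gap2 m z)
    + m * (gap2 m z * gap2 m z) + 2 * m * sq1 z * sq2 z)"
    using lebrun_potential_eq[OF assms] by (auto simp: power2_eq_square)
  \<comment> \<open>The stationarity in \<open>D\<close>: the factor of the derivative \<open>w\<close> of \<open>D\<close> vanishes.\<close>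
  have z: "m * (?D - (sq1 p * exp (- 2 * m * ?D) - sq2 p * exp (2 * m * ?D))) * w = 0" for w
    using D by simp
  show ?thesis unfolding eq
    apply (rule radial_deriv_cong[OF all])
    subgoal using z[of "2 * exp (- 2 * m * ?D) / quot m p"] by (simp add: algebra_simps)
    subgoal using z[of "2 * exp (2 * m * ?D) / quot m p"] by (simp add: algebra_simps)
    done
qed

lemma complex_hessian_lebrun:
  fixes p :: c2
  assumes "m \<ge> 0"
  defines "Q \<equiv> quot m p" and "U \<equiv> exp (- 2 * m * gap2 m p)" and "V \<equiv> exp (2 * m * gap2 m p)"
  shows "complex_hessian (lebrun_potential m) p e1 e1 = of_real (U + 2 * m * sq2 p - 2 * m * sq1 p * U\<^sup>2 / Q)"
    and "complex_hessian (lebrun_potential m) p e2 e2 = of_real (V + 2 * m * sq1 p - 2 * m * sq2 p * V\<^sup>2 / Q)"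
    and "complex_hessian (lebrun_potential m) p e1 e2 = snd p * cnj (fst p) * of_real (2 * m * (1 + 1 / Q))"
    and "complex_hessian (lebrun_potential m) p e2 e1 = fst p * cnj (snd p) * of_real (2 * m * (1 + 1 / Q))"
proof -
  note g = radial_deriv_gap[OF assms(1), of p]
  note e = radial_deriv_exp[OF radial_deriv_mult[OF radial_deriv_const[of "- 2 * m"] g]]
     radial_deriv_exp[OF radial_deriv_mult[OF radial_deriv_const[of "2 * m"] g]]
  note a = radial_deriv_add[OF e(1) radial_deriv_mult[OF radial_deriv_const[of "2 * m"] radial_deriv_sq2]]
  note b = radial_deriv_add[OF e(2) radial_deriv_mult[OF radial_deriv_const[of "2 * m"] radial_deriv_sq1]]
  have UV: "U * V = 1" unfolding U_def V_def by (simp flip: exp_add)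
  have A: "radial_deriv (\<lambda>q. exp (- 2 * m * gap2 m q) + 2 * m * sq2 q) p (- 2 * m * U\<^sup>2 / Q) (2 * m * (1 + 1 / Q))"
    by (rule radial_deriv_cong[OF a]) (unfold U_def[symmetric] V_def[symmetric] Q_def[symmetric],
        insert UV, simp_all add: power2_eq_square distrib_left mult_ac)
  have B: "radial_deriv (\<lambda>q. exp (2 * m * gap2 m q) + 2 * m * sq1 q) p (2 * m * (1 + 1 / Q)) (- 2 * m * V\<^sup>2 / Q)"
    by (rule radial_deriv_cong[OF b]) (unfold U_def[symmetric] V_def[symmetric] Q_def[symmetric],
        insert UV, simp_all add: power2_eq_square distrib_left mult_ac)
  have w: "wirt_bar e1 (\<lambda>q. of_real (lebrun_potential m q)) = (\<lambda>q. fst q * of_real (exp (- 2 * m * gap2 m q) + 2 * m * sq2 q))"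
    "wirt_bar e2 (\<lambda>q. of_real (lebrun_potential m q)) = (\<lambda>q. snd q * of_real (exp (2 * m * gap2 m q) + 2 * m * sq1 q))"
    using wirt_bar_radial[OF radial_deriv_lebrun_potential[OF assms(1)]] by auto
  show "complex_hessian (lebrun_potential m) p e1 e1 = of_real (U + 2 * m * sq2 p - 2 * m * sq1 p * U\<^sup>2 / Q)"
    unfolding complex_hessian_def w wirt_radial[OF A] U_def by (simp add: algebra_simps)
  show "complex_hessian (lebrun_potential m) p e2 e2 = of_real (V + 2 * m * sq1 p - 2 * m * sq2 p * V\<^sup>2 / Q)"
    unfolding complex_hessian_def w wirt_radial[OF B] V_def by (simp add: algebra_simps)
  show "complex_hessian (lebrun_potential m) p e1 e2 = snd p * cnj (fst p) * of_real (2 * m * (1 + 1 / Q))"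
    unfolding complex_hessian_def w wirt_radial[OF B] ..
  show "complex_hessian (lebrun_potential m) p e2 e1 = fst p * cnj (snd p) * of_real (2 * m * (1 + 1 / Q))"
    unfolding complex_hessian_def w wirt_radial[OF A] ..
qed

lemma volume_density_hermitian:
  assumes "complex_hessian \<Phi> p e1 e1 = of_real a" "complex_hessian \<Phi> p e2 e2 = of_real b"
    "complex_hessian \<Phi> p e1 e2 = c" "complex_hessian \<Phi> p e2 e1 = cnj c"
  shows "volume_density \<Phi> p = a * b - (cmod c)\<^sup>2"
  unfolding volume_density_def Let_def kaehler_form_def assms cmod_power2
  by (simp add: e1_def e2_def cscale_def power2_eq_square algebra_simps)

text \<open>With \<open>a = 2 m u\<^sup>2\<close>, \<open>b = 2 m v\<^sup>2\<close> and \<open>Q = 1 + a + b\<close> the exponential factors of the diagonal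
  entries of the Hessian cancel in the determinant, which becomes
  \<open>(1 + b - a/Q) (1 + a - b/Q) - a b (1 + 1/Q)\<^sup>2 = Q - (a + b) = 1\<close>.\<close>

lemma volume_density_lebrun:
  assumes "m \<ge> 0"
  shows "volume_density (lebrun_potential m) p = 1"
proof -
  define Q U V where "Q = quot m p" and "U = exp (- 2 * m * gap2 m p)" and "V = exp (2 * m * gap2 m p)"
  note h = complex_hessian_lebrun[OF assms, of p, folded Q_def U_def V_def]
  have UV: "U * V = 1" unfolding U_def V_def by (simp flip: exp_add)
  define a b where "a = 2 * m * sq1 p * U" and "b = 2 * m * sq2 p * V"
  have Q: "Q = 1 + a + b" unfolding Q_def quot_def a_def b_def U_def V_def by (simp add: algebra_simps)
  have Q1: "Q \<ge> 1" unfolding Q_def using quot_ge_1[OF assms] .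
  have x: "U + 2 * m * sq2 p - 2 * m * sq1 p * U\<^sup>2 / Q = U * (1 + b - a / Q)"
  proof -
    have "2 * m * sq2 p = U * b" using UV unfolding b_def by (simp add: mult_ac)
    then show ?thesis unfolding a_def by (simp add: algebra_simps power2_eq_square)
  qed
  have y: "V + 2 * m * sq1 p - 2 * m * sq2 p * V\<^sup>2 / Q = V * (1 + a - b / Q)"
  proof -
    have "2 * m * sq1 p = V * a" using UV unfolding a_def by (simp add: mult_ac)
    then show ?thesis unfolding b_def by (simp add: algebra_simps power2_eq_square)
  qed
  have z: "(cmod (snd p * cnj (fst p) * of_real (2 * m * (1 + 1 / Q))))\<^sup>2 = a * b * (1 + 1 / Q)\<^sup>2"
  proof -
    have "a * b = (2 * m)\<^sup>2 * (sq1 p * sq2 p) * (U * V)" unfolding a_def b_def by (simp add: power2_eq_square mult_ac)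
    then show ?thesis unfolding UV norm_mult norm_of_real power_mult_distrib power2_abs complex_mod_cnj
      by (simp add: mult_ac)
  qed
  have "volume_density (lebrun_potential m) p = U * (1 + b - a / Q) * (V * (1 + a - b / Q)) - a * b * (1 + 1 / Q)\<^sup>2"
    unfolding z[symmetric] x[symmetric] y[symmetric] by (rule volume_density_hermitian) (use h in \<open>simp_all add: mult_ac\<close>)
  also have "\<dots> = (1 + b - a / Q) * (1 + a - b / Q) - a * b * (1 + 1 / Q)\<^sup>2"
    using UV by (simp add: mult_ac)
  also have "\<dots> = 1"
  proof -
    have "(1 + b - a / Q) * (1 + a - b / Q) * Q - a * b * (1 + 1 / Q)\<^sup>2 * Q = Q"
      using Q1 unfolding power2_eq_square 
      by (simp add: field_simps) (simp add: Q algebra_simps power2_eq_square)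
    then have "((1 + b - a / Q) * (1 + a - b / Q) - a * b * (1 + 1 / Q)\<^sup>2) * Q = 1 * Q"
      by (simp add: left_diff_distrib)
    then show ?thesis using Q1 by (subst (asm) mult_cancel_right) auto
  qed
  finally show ?thesis .
qed

lemma volume_measure_lebrun: "m \<ge> 0 \<Longrightarrow> volume_measure (lebrun_potential m) = lborel"
  unfolding volume_measure_def volume_density_lebrun by (simp add: density_1)

lemma lebrun_potential_axis:
  assumes "m \<ge> 0" "U \<ge> 0" "(cmod \<zeta>)\<^sup>2 = U * exp (2 * m * U)"
  shows "lebrun_potential m (\<zeta>, 0) = U + m * U\<^sup>2"
proof -
  have "gap2 m (\<zeta>, 0) = U"
    by (rule gap_eqI) (use assms in \<open>auto simp: mult.assoc simp flip: exp_add\<close>)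
  then show ?thesis using assms(3) unfolding lebrun_potential_eq[OF assms(1)]
    by (auto simp: mult.assoc simp flip: exp_add)
qed

text \<open>For the converse, the metric is tested on \<open>\<partial>/\<partial>x\<^sub>1\<close> at the point of the axis \<open>z\<^sub>2 = 0\<close> where \<open>u = 1\<close>, that is,
  \<open>z\<^sub>1 = e\<^sup>m\<close>; the value there is \<open>e\<^sup>-\<^sup>2\<^sup>m / (1 + 2m)\<close>.\<close>

lemma lebrun_metric_flat_iff:
  assumes "m \<ge> 0"
  shows "m = 0 \<longleftrightarrow> lebrun_metric m = flat_metric"
proof
  assume [simp]: "m = 0"
  show "lebrun_metric m = flat_metric"
    unfolding lebrun_metric_def fun_eq_iff kaehler_metric_def kaehler_form_def flat_metric_def
      complex_hessian_lebrun[OF assms]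
    by (auto simp: cscale_def inner_prod_def inner_complex_def)
next
  assume flat: "lebrun_metric m = flat_metric"
  let ?\<zeta> = "of_real (exp m) :: complex"
  let ?p = "(?\<zeta>, 0) :: c2"
  have s: "(cmod ?\<zeta>)\<^sup>2 = 1 * exp (2 * m * 1)" by (simp flip: exp_of_nat_mult)
  have g: "gap2 m ?p = 1"
    by (rule gap_eqI) (use assms s in \<open>auto simp: mult.assoc simp flip: exp_add\<close>)
  have Q: "quot m ?p = 1 + 2 * m" unfolding quot_def g using s by (simp flip: exp_add)
  let ?h = "exp (- 2 * m) - 2 * m * exp (2 * m) * (exp (- 2 * m))\<^sup>2 / (1 + 2 * m)"
  have h: "complex_hessian (lebrun_potential m) ?p e1 e1 = of_real ?h"
    unfolding complex_hessian_lebrun[OF assms] g Q using s by simp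
  have "lebrun_metric m ?p e1 e1 = 1" unfolding flat flat_metric_def e1_def by simp
  then have h1: "?h = 1"
    unfolding lebrun_metric_def kaehler_metric_def kaehler_form_def h
    by (simp add: e1_def cscale_def)
  have "?h = exp (- 2 * m) - 2 * m * exp (- 2 * m) / (1 + 2 * m)"
    by (simp add: mult.assoc flip: exp_of_nat_mult exp_add)
  also have "\<dots> = exp (- 2 * m) / (1 + 2 * m)"
    using assms by (simp add: field_simps)
  finally have "exp (- 2 * m) / (1 + 2 * m) = 1" using h1 by metis
  then have "exp (- 2 * m) = 1 + 2 * m" using assms by (simp add: field_simps split: if_splits)
  moreover have "exp (- 2 * m) \<le> 1" using assms by simp
  ultimately show "m = 0" using assms by linarith
qed

section \<open>Invariance of Lebesgue measure and the Gaussian integral\<close>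

lemma nn_integral_lborel_translate:
  fixes f :: "'a::euclidean_space \<Rightarrow> ennreal"
  assumes [measurable]: "f \<in> borel_measurable borel"
  shows "(\<integral>\<^sup>+x. f (c + x) \<partial>lborel) = (\<integral>\<^sup>+x. f x \<partial>lborel)"
proof -
  have "(\<integral>\<^sup>+x. f (c + x) \<partial>lborel) = (\<integral>\<^sup>+x. f x \<partial>distr lborel borel ((+) c))"
    by (subst nn_integral_distr) auto
  then show ?thesis by (simp add: lborel_distr_plus)
qed

text \<open>Uniqueness of the translation invariant measure, by Fubini's theorem. Let \<open>B\<close> be the unit ball. The
  integral of \<open>1\<^sub>A(T x) 1\<^sub>B(y - T x)\<close> over all \<open>x\<close> and \<open>y\<close> is \<open>\<lambda>(B)\<close> times the image measure of \<open>A\<close> if \<open>y\<close> is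
  integrated first. If \<open>x\<close> is first translated by \<open>T\<^sup>-\<^sup>1 y\<close>, it is \<open>\<lambda>(B) \<lambda>(A)\<close>, because \<open>- T x \<in> B\<close> iff \<open>x \<in> B\<close>.\<close>

lemma distr_lborel_orthogonal:
  fixes T :: "'a::euclidean_space \<Rightarrow> 'a"
  assumes T: "orthogonal_transformation T"
  shows "distr lborel borel T = (lborel :: 'a measure)"
proof (rule measure_eqI)
  show "sets (distr lborel borel T) = sets (lborel :: 'a measure)" by simp
next
  fix A assume "A \<in> sets (distr lborel borel T)"
  then have A[measurable]: "A \<in> sets borel" by simp
  have lin: "linear T" using T by (rule orthogonal_transformation_linear)
  then have "continuous_on UNIV T" by (rule linear_continuous_on[OF linear_conv_bounded_linear[THEN iffD1]])
  then have T_meas[measurable]: "T \<in> borel_measurable borel" by (rule borel_measurable_continuous_onI)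
  define B :: "'a set" where "B = ball 0 1"
  have [measurable]: "B \<in> sets borel" unfolding B_def by simp
  have B: "- T x \<in> B \<longleftrightarrow> x \<in> B" for x
    unfolding B_def using orthogonal_transformation_norm[OF T] by simp
  obtain S where S: "\<And>y. T (S y) = y"
    using orthogonal_transformation_surj[OF T] by (metis surjE)
  let ?\<mu> = "\<lambda>C. emeasure lborel C :: ennreal"
  have "?\<mu> B * emeasure (distr lborel borel T) A = (\<integral>\<^sup>+x. ?\<mu> B * indicator A (T x) \<partial>lborel)"
    by (simp add: nn_integral_cmult nn_integral_distr flip: nn_integral_indicator)
  also have "\<dots> = (\<integral>\<^sup>+x. \<integral>\<^sup>+y. indicator A (T x) * indicator B (- T x + y) \<partial>lborel \<partial>lborel)"
  proof (rule nn_integral_cong)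
    fix x
    have "(\<integral>\<^sup>+y. indicator A (T x) * indicator B (- T x + y) \<partial>lborel) =
      indicator A (T x) * (\<integral>\<^sup>+y. indicator B (- T x + y) \<partial>lborel)"
      by (subst nn_integral_cmult) auto
    also have "(\<integral>\<^sup>+y. indicator B (- T x + y) \<partial>lborel) = ?\<mu> B"
      by (subst nn_integral_lborel_translate) auto
    finally show "?\<mu> B * indicator A (T x) = (\<integral>\<^sup>+y. indicator A (T x) * indicator B (- T x + y) \<partial>lborel)"
      by (simp add: mult.commute)
  qed
  also have "\<dots> = (\<integral>\<^sup>+y. \<integral>\<^sup>+x. indicator A (T x) * indicator B (- T x + y) \<partial>lborel \<partial>lborel)"
    by (rule lborel_pair.Fubini') measurable
  also have "\<dots> = (\<integral>\<^sup>+y. \<integral>\<^sup>+x. indicator A (T x + y) * indicator B x \<partial>lborel \<partial>lborel)"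
  proof (rule nn_integral_cong)
    fix y
    have "(\<integral>\<^sup>+x. indicator A (T x) * indicator B (- T x + y) \<partial>lborel) =
      (\<integral>\<^sup>+x. indicator A (T (S y + x)) * indicator B (- T (S y + x) + y) \<partial>lborel)"
      by (subst nn_integral_lborel_translate) auto
    also have "\<dots> = (\<integral>\<^sup>+x. indicator A (T x + y) * indicator B x \<partial>lborel)"
      by (intro nn_integral_cong) (simp add: linear_add[OF lin] S add.commute indicator_def B)
    finally show "(\<integral>\<^sup>+x. indicator A (T x) * indicator B (- T x + y) \<partial>lborel :: ennreal) = \<dots>" .
  qed
  also have "\<dots> = (\<integral>\<^sup>+x. \<integral>\<^sup>+y. indicator A (T x + y) * indicator B x \<partial>lborel \<partial>lborel)"
    by (rule lborel_pair.Fubini') measurable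
  also have "\<dots> = (\<integral>\<^sup>+x. ?\<mu> A * indicator B x \<partial>lborel)"
  proof (rule nn_integral_cong)
    fix x
    have "(\<integral>\<^sup>+y. indicator A (T x + y) * indicator B x \<partial>lborel) =
      (\<integral>\<^sup>+y. indicator A (T x + y) \<partial>lborel) * indicator B x"
      by (subst nn_integral_multc) auto
    also have "(\<integral>\<^sup>+y. indicator A (T x + y) \<partial>lborel) = ?\<mu> A"
      by (subst nn_integral_lborel_translate) auto
    finally show "(\<integral>\<^sup>+y. indicator A (T x + y) * indicator B x \<partial>lborel) = ?\<mu> A * indicator B x" .
  qed
  also have "\<dots> = ?\<mu> A * ?\<mu> B" by (simp add: nn_integral_cmult)
  finally have *: "?\<mu> B * emeasure (distr lborel borel T) A = ?\<mu> B * ?\<mu> A" by (simp add: mult.commute)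
  have B_fin: "?\<mu> B < \<infinity>" unfolding B_def by (rule emeasure_lborel_ball_finite)
  have "?\<mu> B \<noteq> 0"
    using open_not_negligible[of B] unfolding B_def
    by (simp add: negligible_iff_null_sets null_sets_def)
  then show "emeasure (distr lborel borel T) A = ?\<mu> A"
    using * B_fin by (auto simp: ennreal_mult_cancel_left)
qed

text \<open>On the shell \<open>n \<le> \<bar>x\<bar> < n + 1\<close> the integrand is at most \<open>e\<^bsup>-a n\<^sup>2\<^esup>\<close>, and the volume of the shell grows only
  polynomially in \<open>n\<close>.\<close>

lemma integrable_gaussian:
  fixes a :: real
  assumes "a > 0"
  shows "integrable lborel (\<lambda>x::'a::euclidean_space. exp (- a * (norm x)\<^sup>2))"
proof -
  let ?d = "DIM('a)"
  let ?v = "unit_ball_vol (real ?d)"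
  have "(\<lambda>n. exp (- a * (real n)\<^sup>2) * (?v * (real n + 1) ^ ?d)) \<in> O(\<lambda>n. 1 / (real n)\<^sup>2)"
    using assms by real_asymp
  then have sm: "summable (\<lambda>n. exp (- a * (real n)\<^sup>2) * (?v * (real n + 1) ^ ?d))"
    by (rule summable_comparison_test_bigo[rotated]) (use inverse_power_summable[of 2] in \<open>auto simp: divide_simps\<close>)
  have "(\<integral>\<^sup>+x. ennreal (exp (- a * (norm (x::'a))\<^sup>2)) \<partial>lborel) \<le>
    (\<integral>\<^sup>+x. (\<Sum>n. ennreal (exp (- a * (real n)\<^sup>2)) * indicator (ball (0::'a) (real n + 1)) x) \<partial>lborel)"
  proof (rule nn_integral_mono)
    fix x :: 'a
    let ?n = "nat \<lfloor>norm x\<rfloor>"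
    have n: "real ?n \<le> norm x" "norm x < real ?n + 1" by (simp_all add: of_nat_nat)
    have "(real ?n)\<^sup>2 \<le> (norm x)\<^sup>2" using n(1) by (intro power_mono) auto
    then have "exp (- a * (norm x)\<^sup>2) \<le> exp (- a * (real ?n)\<^sup>2)" using assms by simp
    then have "ennreal (exp (- a * (norm x)\<^sup>2)) \<le>
      ennreal (exp (- a * (real ?n)\<^sup>2)) * indicator (ball 0 (real ?n + 1)) x" using n(2) by (simp add: ennreal_leI)
    also have "\<dots> = (\<Sum>n\<in>{?n}. ennreal (exp (- a * (real n)\<^sup>2)) * indicator (ball 0 (real n + 1)) x)" by simp
    also have "\<dots> \<le> (\<Sum>n. ennreal (exp (- a * (real n)\<^sup>2)) * indicator (ball 0 (real n + 1)) x)"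
      by (rule sum_le_suminf) auto
    finally show "ennreal (exp (- a * (norm x)\<^sup>2)) \<le> \<dots>" .
  qed
  also have "\<dots> = (\<Sum>n. ennreal (exp (- a * (real n)\<^sup>2)) * emeasure lborel (ball (0::'a) (real n + 1)))"
  proof (subst nn_integral_suminf)
    fix n :: nat
    have [measurable]: "ball (0::'a) (real n + 1) \<in> sets borel" by simp
    show "(\<lambda>x. ennreal (exp (- a * (real n)\<^sup>2)) * indicator (ball 0 (real n + 1)) x) \<in> borel_measurable (lborel :: 'a measure)"
      by measurable
  qed (simp add: nn_integral_cmult_indicator)
  also have "\<dots> = (\<Sum>n. ennreal (exp (- a * (real n)\<^sup>2) * (?v * (real n + 1) ^ ?d)))"
    by (subst emeasure_ball) (auto simp: ennreal_mult unit_ball_vol_nonneg)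
  also have "\<dots> < \<infinity>"
    by (subst suminf_ennreal2[OF _ sm]) (auto simp: unit_ball_vol_nonneg)
  finally show ?thesis
    by (intro integrableI_bounded) auto
qed

section \<open>Power series on circles\<close>

text \<open>The uniform probability measure on the circle, parametrised by the unit interval.\<close>

definition circle :: "real measure" where
  "circle = density lborel (\<lambda>t. ennreal (indicator {0..1} t))"

lemma sets_circle [measurable_cong]: "sets circle = sets borel"
  and space_circle: "space circle = UNIV"
  unfolding circle_def by auto

lemma integral_circle:
  fixes f :: "real \<Rightarrow> 'a::euclidean_space"
  assumes "f \<in> borel_measurable borel"
  shows "(\<integral>t. f t \<partial>circle) = (\<integral>t. indicator {0..1} t *\<^sub>R f t \<partial>lborel)"
  unfolding circle_def using assms by (subst integral_density) auto

lemma emeasure_circle: "emeasure circle UNIV = 1"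
  unfolding circle_def by (subst emeasure_density) (auto simp: ennreal_indicator)

lemma finite_measure_circle: "finite_measure circle"
  by (rule finite_measureI) (simp add: space_circle emeasure_circle)

interpretation circle: finite_measure circle by (rule finite_measure_circle)

lemma measure_circle: "measure circle UNIV = 1"
  unfolding measure_def emeasure_circle by simp

lemma emeasure_space_circle [simp]: "emeasure circle (space circle) = 1"
  by (simp add: space_circle emeasure_circle)

lemma integral_circle_cis:
  fixes n :: int
  shows "(\<integral>t. cis (2 * pi * of_int n * t) \<partial>circle) = (if n = 0 then 1 else 0)"
proof (cases "n = 0")
  case True
  then show ?thesis by (simp add: space_circle measure_circle)
next
  case False
  define A where "A = of_real (2 * pi * of_int n) * \<i>"
  have A: "A \<noteq> 0" unfolding A_def using False by simp
  have cis: "cis (2 * pi * of_int n * t) = exp (t *\<^sub>R A)" for t :: real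
    unfolding A_def cis_conv_exp by (simp add: scaleR_conv_of_real mult_ac)
  let ?F = "\<lambda>t. exp (t *\<^sub>R A) / A"
  have "(\<integral>t. indicator {0..1} t *\<^sub>R cis (2 * pi * of_int n * t) \<partial>lborel) = ?F 1 - ?F 0"
  proof (rule integral_FTC_Icc)
    fix t :: real
    from has_vector_derivative_divide[OF exp_scaleR_has_vector_derivative_right[of A t "{0..1}"], of A]
    show "(?F has_vector_derivative cis (2 * pi * of_int n * t)) (at t within {0..1})"
      using A unfolding cis by simp
  qed (auto intro!: continuous_intros)
  moreover have "exp A = 1" using cis[of 1] cis_multiple_2pi[of "of_int n"] by simp
  moreover have "(\<integral>t. cis (2 * pi * of_int n * t) \<partial>circle) =
    (\<integral>t. indicator {0..1} t *\<^sub>R cis (2 * pi * of_int n * t) \<partial>lborel)"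
    by (rule integral_circle) (auto intro!: borel_measurable_continuous_onI continuous_intros)
  ultimately show ?thesis using False by simp
qed


abbreviation turn :: "real \<Rightarrow> complex" where "turn t \<equiv> cis (2 * pi * t)"

lemma continuous_on_turn: "continuous_on A turn"
  by (intro continuous_intros)

lemma borel_measurable_turn [measurable]: "turn \<in> borel_measurable borel"
  by (rule borel_measurable_continuous_onI[OF continuous_on_turn])

lemma integrable_circle_bounded:
  fixes f :: "real \<Rightarrow> complex"
  assumes "f \<in> borel_measurable borel" "\<And>t. norm (f t) \<le> M"
  shows "integrable circle f"
  by (rule circle.integrable_const_bound[of _ M])
     (use assms in \<open>auto cong: measurable_cong_sets simp: sets_circle\<close>)

lemma turn_power_mult_cnj: "turn t ^ n * cnj (turn t ^ k) = cis (2 * pi * of_int (int n - int k) * t)"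
proof -
  have "turn t ^ n = cis (2 * pi * n * t)" for n by (simp add: Complex.DeMoivre mult_ac)
  then show ?thesis by (simp add: cis_cnj cis_mult algebra_simps)
qed

lemma integral_circle_sum_sq:
  fixes a :: "nat \<Rightarrow> complex"
  shows "(\<integral>t. of_real ((cmod (\<Sum>n<N. a n * turn t ^ n))\<^sup>2) \<partial>circle) = (of_real (\<Sum>n<N. (cmod (a n))\<^sup>2) :: complex)"
proof -
  have "of_real ((cmod (\<Sum>n<N. a n * turn t ^ n))\<^sup>2) =
      (\<Sum>n<N. \<Sum>k<N. a n * cnj (a k) * cis (2 * pi * of_int (int n - int k) * t))" for t
    unfolding complex_norm_square cnj_sum sum_product turn_power_mult_cnj[symmetric]
    by (simp add: mult_ac)
  then have "(\<integral>t. of_real ((cmod (\<Sum>n<N. a n * turn t ^ n))\<^sup>2) \<partial>circle) =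
     (\<integral>t. (\<Sum>n<N. \<Sum>k<N. a n * cnj (a k) * cis (2 * pi * of_int (int n - int k) * t)) \<partial>circle)"
    by simp
  also have "\<dots> = (\<Sum>n<N. \<Sum>k<N. a n * cnj (a k) * (\<integral>t. cis (2 * pi * of_int (int n - int k) * t) \<partial>circle))"
  proof -
    have i: "integrable circle (\<lambda>t. cis (2 * pi * of_int (int n - int k) * t))" for n k
      by (rule integrable_circle_bounded[where M = 1])
         (auto intro!: borel_measurable_continuous_onI continuous_intros)
    have j: "integrable circle (\<lambda>t. a n * cnj (a k) * cis (2 * pi * of_int (int n - int k) * t))" for n k
      by (rule integrable_mult_right[OF i])
    show ?thesis
      by (subst Bochner_Integration.integral_sum, intro Bochner_Integration.integrable_sum j, intro sum.cong refl,
          subst Bochner_Integration.integral_sum, rule j, intro sum.cong refl, rule integral_mult_right_zero)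
  qed
  also have "\<dots> = (\<Sum>n<N. \<Sum>k<N. if n = k then a n * cnj (a k) else 0)"
    unfolding integral_circle_cis by (intro sum.cong refl) auto
  also have "\<dots> = (\<Sum>n<N. a n * cnj (a n))"
    by (intro sum.cong refl) (simp add: sum.delta)
  also have "\<dots> = of_real (\<Sum>n<N. (cmod (a n))\<^sup>2)"
    by (simp only: of_real_sum complex_norm_square)
  finally show ?thesis .
qed

text \<open>Both identities hold for the partial sums by orthogonality of the characters, and pass to the limit
  by dominated convergence, since the partial sums are bounded by the sum of the absolute values.\<close>

lemma circle_power_series:
  fixes a :: "nat \<Rightarrow> complex"
  assumes a: "summable (\<lambda>n. norm (a n))"
    and g: "\<And>t. (\<lambda>n. a n * turn t ^ n) sums g t"
  shows parseval_circle: "(\<integral>\<^sup>+t. ennreal ((cmod (g t))\<^sup>2) \<partial>circle) = (\<Sum>n. ennreal ((cmod (a n))\<^sup>2))"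
    and mean_circle: "(\<integral>t. g t \<partial>circle) = a 0"
proof -
  define S where "S N t = (\<Sum>n<N. a n * turn t ^ n)" for N t
  define M where "M = (\<Sum>n. norm (a n))"
  have S_meas[measurable]: "S N \<in> borel_measurable borel" for N
    unfolding S_def by (auto intro!: borel_measurable_continuous_onI continuous_intros)
  have S_le: "norm (S N t) \<le> M" for N t
  proof -
    have "norm (S N t) \<le> (\<Sum>n<N. norm (a n))"
      unfolding S_def by (rule sum_norm_le) (simp add: norm_mult norm_power)
    also have "\<dots> \<le> M" unfolding M_def by (rule sum_le_suminf[OF a]) auto
    finally show ?thesis .
  qed
  have Sg: "(\<lambda>N. S N t) \<longlonglongrightarrow> g t" for t
    using g[of t] unfolding sums_def S_def .
  have g_meas[measurable]: "g \<in> borel_measurable borel"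
    by (rule borel_measurable_LIMSEQ_metric[OF S_meas Sg])
  have g_le: "norm (g t) \<le> M" for t
    by (rule Lim_bounded[OF tendsto_norm[OF Sg], of 0]) (simp add: S_le)
  have "(\<lambda>N. \<integral>t. S N t \<partial>circle) \<longlonglongrightarrow> (\<integral>t. g t \<partial>circle)"
    by (rule integral_dominated_convergence[where w = "\<lambda>_. M"]) (auto simp: S_le Sg)
  moreover have "(\<lambda>N. \<integral>t. S N t \<partial>circle) \<longlonglongrightarrow> a 0"
  proof (rule tendsto_eventually, rule eventually_sequentiallyI[of 1])
    fix N :: nat assume N: "1 \<le> N"
    have i: "integrable circle (\<lambda>t. turn t ^ n)" for n
      by (rule integrable_circle_bounded[where M = 1])
         (auto intro!: borel_measurable_continuous_onI continuous_intros simp: norm_power)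
    have "turn t ^ n = cis (2 * pi * of_int (int n) * t)" for n :: nat and t
      by (simp add: Complex.DeMoivre mult_ac)
    then have "(\<integral>t. turn t ^ n \<partial>circle) = (if n = 0 then 1 else 0)" for n :: nat
      using integral_circle_cis[of "int n"] by simp
    then have "(\<integral>t. S N t \<partial>circle) = (\<Sum>n<N. a n * (if n = 0 then 1 else 0))"
      unfolding S_def using i by (simp add: Bochner_Integration.integral_sum)
    also have "\<dots> = a 0" using N by (simp add: if_distrib sum.delta cong: if_cong)
    finally show "(\<integral>t. S N t \<partial>circle) = a 0" .
  qed
  ultimately show "(\<integral>t. g t \<partial>circle) = a 0" by (rule LIMSEQ_unique)
  have sq_le: "(norm z)\<^sup>2 \<le> M\<^sup>2" if "norm z \<le> M" for z :: complex using that by (intro power_mono) auto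
  have ig: "integrable circle (\<lambda>t. (cmod (g t))\<^sup>2)"
    by (rule circle.integrable_const_bound[of _ "M\<^sup>2"]) (auto simp: sq_le g_le)
  have iS: "integrable circle (\<lambda>t. (cmod (S N t))\<^sup>2)" for N
    by (rule circle.integrable_const_bound[of _ "M\<^sup>2"]) (auto simp: sq_le S_le)
  have "(\<lambda>N. \<integral>t. (cmod (S N t))\<^sup>2 \<partial>circle) \<longlonglongrightarrow> (\<integral>t. (cmod (g t))\<^sup>2 \<partial>circle)"
    by (rule integral_dominated_convergence[where w = "\<lambda>_. M\<^sup>2"])
       (auto simp: sq_le S_le intro!: tendsto_intros Sg)
  moreover have "(\<integral>t. (cmod (S N t))\<^sup>2 \<partial>circle) = (\<Sum>n<N. (cmod (a n))\<^sup>2)" for N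
    using integral_circle_sum_sq[of a N] unfolding S_def[symmetric] integral_complex_of_real of_real_eq_iff .
  ultimately have "(\<lambda>n. (cmod (a n))\<^sup>2) sums (\<integral>t. (cmod (g t))\<^sup>2 \<partial>circle)"
    unfolding sums_def by simp
  then have "(\<Sum>n. ennreal ((cmod (a n))\<^sup>2)) = ennreal (\<integral>t. (cmod (g t))\<^sup>2 \<partial>circle)"
    by (subst suminf_ennreal2) (auto simp: sums_iff)
  also have "\<dots> = (\<integral>\<^sup>+t. ennreal ((cmod (g t))\<^sup>2) \<partial>circle)"
    by (rule nn_integral_eq_integral[symmetric, OF ig]) auto
  finally show "(\<integral>\<^sup>+t. ennreal ((cmod (g t))\<^sup>2) \<partial>circle) = (\<Sum>n. ennreal ((cmod (a n))\<^sup>2))" ..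
qed

lemma entire_power_series_circle:
  fixes a :: "nat \<Rightarrow> complex"
  assumes g: "\<And>z. (\<lambda>n. a n * z ^ n) sums g z"
  shows parseval_entire: "(\<integral>\<^sup>+t. ennreal ((cmod (g (turn t * z)))\<^sup>2) \<partial>circle) =
      (\<Sum>n. ennreal ((cmod (a n * z ^ n))\<^sup>2))"
    and mean_entire: "(\<integral>t. g (turn t * z) \<partial>circle) = g 0"
proof -
  have "summable (\<lambda>n. a n * (of_real (cmod z + 1)) ^ n)" using g by (rule sums_summable)
  then have s: "summable (\<lambda>n. norm (a n * z ^ n))" by (rule powser_insidea) simp
  have e: "(\<lambda>n. a n * z ^ n * turn t ^ n) sums g (turn t * z)" for t
    using g[of "turn t * z"] by (simp add: power_mult_distrib mult_ac)
  show "(\<integral>\<^sup>+t. ennreal ((cmod (g (turn t * z)))\<^sup>2) \<partial>circle) = (\<Sum>n. ennreal ((cmod (a n * z ^ n))\<^sup>2))"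
    by (rule parseval_circle[OF s e])
  have "g 0 = a 0" using g[of 0] by (simp add: sums_unique2[OF _ powser_sums_zero])
  then show "(\<integral>t. g (turn t * z) \<partial>circle) = g 0"
    using mean_circle[OF s e] by simp
qed

section \<open>Entire functions of two variables\<close>

lemma holomorphic2_fst: "holomorphic2 fst" and holomorphic2_snd: "holomorphic2 snd"
  and holomorphic2_const: "holomorphic2 (\<lambda>_. c)"
proof -
  have "(fst has_derivative (\<lambda>h. 1 * fst h + 0 * snd h)) (at p)"
    "(snd has_derivative (\<lambda>h. 0 * fst h + 1 * snd h)) (at p)"
    "((\<lambda>_. c) has_derivative (\<lambda>h. 0 * fst h + 0 * snd h)) (at p)" for p :: c2
    by (auto intro!: derivative_eq_intros)
  then show "holomorphic2 fst" "holomorphic2 snd" "holomorphic2 (\<lambda>_. c)"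
    unfolding holomorphic2_def by blast+
qed

lemma holomorphic2_add:
  assumes "holomorphic2 f" "holomorphic2 g"
  shows "holomorphic2 (\<lambda>p. f p + g p)"
  unfolding holomorphic2_def
proof
  fix p
  obtain a b a' b' where
    "(f has_derivative (\<lambda>h. a * fst h + b * snd h)) (at p)"
    "(g has_derivative (\<lambda>h. a' * fst h + b' * snd h)) (at p)"
    using assms unfolding holomorphic2_def by metis
  from has_derivative_add[OF this]
  have "((\<lambda>p. f p + g p) has_derivative (\<lambda>h. (a + a') * fst h + (b + b') * snd h)) (at p)"
    by (simp add: algebra_simps)
  then show "\<exists>a b. ((\<lambda>p. f p + g p) has_derivative (\<lambda>h. a * fst h + b * snd h)) (at p)" by blast
qed

lemma holomorphic2_mult:
  assumes "holomorphic2 f" "holomorphic2 g"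
  shows "holomorphic2 (\<lambda>p. f p * g p)"
  unfolding holomorphic2_def
proof
  fix p
  obtain a b a' b' where
    "(f has_derivative (\<lambda>h. a * fst h + b * snd h)) (at p)"
    "(g has_derivative (\<lambda>h. a' * fst h + b' * snd h)) (at p)"
    using assms unfolding holomorphic2_def by metis
  from has_derivative_mult[OF this]
  have "((\<lambda>p. f p * g p) has_derivative (\<lambda>h. (f p * a' + a * g p) * fst h + (f p * b' + b * g p) * snd h)) (at p)"
    by (simp add: algebra_simps)
  then show "\<exists>a b. ((\<lambda>p. f p * g p) has_derivative (\<lambda>h. a * fst h + b * snd h)) (at p)" by blast
qed

lemma holomorphic2_compose:
  assumes "holomorphic2 f" "\<phi> holomorphic_on UNIV"
  shows "holomorphic2 (\<lambda>p. \<phi> (f p))"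
  unfolding holomorphic2_def
proof
  fix p
  obtain a b where f: "(f has_derivative (\<lambda>h. a * fst h + b * snd h)) (at p)"
    using assms unfolding holomorphic2_def by metis
  have "(\<phi> has_derivative (\<lambda>h. deriv \<phi> (f p) * h)) (at (f p))"
    using holomorphic_derivI[OF assms(2) open_UNIV] unfolding has_field_derivative_def by auto
  from has_derivative_compose[OF f this]
  have "((\<lambda>p. \<phi> (f p)) has_derivative (\<lambda>h. (deriv \<phi> (f p) * a) * fst h + (deriv \<phi> (f p) * b) * snd h)) (at p)"
    by (simp add: algebra_simps)
  then show "\<exists>a b. ((\<lambda>p. \<phi> (f p)) has_derivative (\<lambda>h. a * fst h + b * snd h)) (at p)" by blast
qed

lemma holomorphic2_cmult: "holomorphic2 f \<Longrightarrow> holomorphic2 (\<lambda>p. c * f p)"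
  by (intro holomorphic2_mult holomorphic2_const)

lemma holomorphic2_diff: "holomorphic2 f \<Longrightarrow> holomorphic2 g \<Longrightarrow> holomorphic2 (\<lambda>p. f p - g p)"
  using holomorphic2_add[of f "\<lambda>p. (-1) * g p"] holomorphic2_cmult[of g "-1"] by simp

lemma holomorphic2_sum: "(\<And>i. i \<in> I \<Longrightarrow> holomorphic2 (f i)) \<Longrightarrow> holomorphic2 (\<lambda>p. \<Sum>i\<in>I. f i p)"
  by (induction I rule: infinite_finite_induct) (auto intro: holomorphic2_const holomorphic2_add)

lemma holomorphic2_power: "holomorphic2 f \<Longrightarrow> holomorphic2 (\<lambda>p. f p ^ n)"
  by (induction n) (auto intro: holomorphic2_const holomorphic2_mult)

lemma holomorphic2_translate:
  assumes "holomorphic2 f"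
  shows "holomorphic2 (\<lambda>p. f (c + p))"
  unfolding holomorphic2_def
proof
  fix p
  obtain a b where f: "(f has_derivative (\<lambda>h. a * fst h + b * snd h)) (at (c + p))"
    using assms unfolding holomorphic2_def by metis
  have "((\<lambda>p. c + p) has_derivative (\<lambda>h. h)) (at p)" by (auto intro!: derivative_eq_intros)
  from has_derivative_compose[OF this f]
  show "\<exists>a b. ((\<lambda>p. f (c + p)) has_derivative (\<lambda>h. a * fst h + b * snd h)) (at p)" by blast
qed

lemma holomorphic2_continuous: "holomorphic2 f \<Longrightarrow> continuous_on A f"
  unfolding holomorphic2_def
  by (metis has_derivative_continuous continuous_at_imp_continuous_on)

lemma holomorphic2_measurable: "holomorphic2 f \<Longrightarrow> f \<in> borel_measurable borel"
  by (intro borel_measurable_continuous_onI holomorphic2_continuous)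

lemma holomorphic2_line:
  assumes "holomorphic2 f"
  shows "(\<lambda>\<zeta>. f (a + \<zeta> * b, a' + \<zeta> * b')) holomorphic_on S"
proof (rule holomorphic_on_subset[OF _ subset_UNIV], rule holomorphic_onI)
  fix \<zeta>
  obtain c d where f: "(f has_derivative (\<lambda>h. c * fst h + d * snd h)) (at (a + \<zeta> * b, a' + \<zeta> * b'))"
    using assms unfolding holomorphic2_def by metis
  have "((\<lambda>\<zeta>. (a + \<zeta> * b, a' + \<zeta> * b')) has_derivative (\<lambda>h. (h * b, h * b'))) (at \<zeta>)"
    by (auto intro!: derivative_eq_intros)
  from has_derivative_compose[OF this f]
  have "((\<lambda>\<zeta>. f (a + \<zeta> * b, a' + \<zeta> * b')) has_derivative (\<lambda>h. (c * b + d * b') * h)) (at \<zeta>)"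
    by (simp add: algebra_simps)
  then show "(\<lambda>\<zeta>. f (a + \<zeta> * b, a' + \<zeta> * b')) field_differentiable at \<zeta> within UNIV"
    unfolding field_differentiable_def has_field_derivative_def by auto
qed

lemma entire_power_series:
  assumes "g holomorphic_on UNIV"
  shows "(\<lambda>n. (deriv ^^ n) g 0 / fact n * z ^ n) sums g z"
proof -
  have "(\<lambda>n. (deriv ^^ n) g 0 / fact n * (z - 0) ^ n) sums g z"
    by (rule holomorphic_power_series[where r = "cmod z + 1"])
       (use assms in \<open>auto intro: holomorphic_on_subset\<close>)
  then show ?thesis by simp
qed

text \<open>Power series expansion in one variable at a time. It yields Parseval's identity on tori by applying
  the one-variable identity twice, without rearranging a double series.\<close>

definition expands :: "(c2 \<Rightarrow> complex) \<Rightarrow> (nat \<Rightarrow> complex \<Rightarrow> complex) \<Rightarrow> (nat \<Rightarrow> nat \<Rightarrow> complex) \<Rightarrow> bool" where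
  "expands h c a \<longleftrightarrow> (\<forall>j w. (\<lambda>k. a j k * w ^ k) sums c j w) \<and> (\<forall>z w. (\<lambda>j. c j w * z ^ j) sums h (z, w))"

text \<open>The coefficients \<open>c\<^sub>j(w)\<close> of the expansion in the first variable are Cauchy integrals. Applying Cauchy's
  formula in the second variable and exchanging the two contour integrals, they satisfy Cauchy's
  formula themselves. So they are entire and have power series.\<close>

lemma holomorphic2_expands:
  assumes h: "holomorphic2 h"
  shows "\<exists>c a. expands h c a"
proof -
  define I where "I j w = contour_integral (circlepath 0 1) (\<lambda>u. h (u, w) / u ^ Suc j)" for j w
  define c where "c j w = I j w / (2 * pi * \<i>)" for j w
  have hol1: "(\<lambda>z. h (z, w)) holomorphic_on S" for w S
    using holomorphic2_line[OF h, of 0 1 w 0 S] by simp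
  have hol2: "(\<lambda>w. h (z, w)) holomorphic_on S" for z S
    using holomorphic2_line[OF h, of z 0 0 1 S] by simp
  have c: "(\<lambda>j. c j w * z ^ j) sums h (z, w)" for z w
  proof -
    have "I j w = 2 * pi * \<i> / fact j * (deriv ^^ j) (\<lambda>z. h (z, w)) 0" for j
      using Cauchy_contour_integral_circlepath[of 0 1 "\<lambda>z. h (z, w)" 0 j]
      by (simp add: I_def hol1 holomorphic_on_imp_continuous_on)
    then have "c j w = (deriv ^^ j) (\<lambda>z. h (z, w)) 0 / fact j" for j
      unfolding c_def by simp
    then show ?thesis using entire_power_series[OF hol1, of w z] by simp
  qed
  have cont: "continuous_on UNIV (I j)" for j
  proof -
    have "I j w = integral (cbox 0 1) (\<lambda>t. h (circlepath 0 1 t, w) / (circlepath 0 1 t) ^ Suc j *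
        vector_derivative (circlepath 0 1) (at t))" for w
      unfolding I_def contour_integral_integral by simp
    moreover have "continuous_on UNIV (\<lambda>w. integral (cbox 0 1) (\<lambda>t. h (circlepath 0 1 t, w) / (circlepath 0 1 t) ^ Suc j *
        vector_derivative (circlepath 0 1) (at t)))"
      unfolding vector_derivative_circlepath unfolding circlepath
      by (intro integral_continuous_on_param)
         (auto simp: case_prod_unfold intro!: continuous_intros
            continuous_on_compose2[OF holomorphic2_continuous[OF h, of UNIV]])
    ultimately show ?thesis by simp
  qed
  have hol: "c j holomorphic_on UNIV" for j
  proof (rule holomorphic_onI)
    fix w0 :: complex
    define R where "R = cmod w0 + 1"
    have R: "R > 0" unfolding R_def by (simp add: add_nonneg_pos)
    let ?C = "circlepath 0 R"
    have I: "((\<lambda>v. I j v / (v - w) ^ 1) has_contour_integral (2 * pi * \<i> * I j w)) ?C"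
      if w: "w \<in> ball 0 R" for w
    proof -
      have w_notin: "v \<noteq> w" if "v \<in> path_image ?C" for v
        using that w R by auto
      have "contour_integral ?C (\<lambda>v. I j v / (v - w)) =
        contour_integral ?C (\<lambda>v. contour_integral (circlepath 0 1) (\<lambda>u. h (u, v) / u ^ Suc j / (v - w)))"
        unfolding I_def
        by (intro contour_integral_cong refl contour_integral_div[symmetric])
           (auto intro!: contour_integrable_continuous_circlepath continuous_intros
             holomorphic_on_imp_continuous_on[OF hol1])
      also have "\<dots> = contour_integral (circlepath 0 1) (\<lambda>u. contour_integral ?C (\<lambda>v. h (u, v) / u ^ Suc j / (v - w)))"
      proof (rule contour_integral_swap)
        show "continuous_on (path_image ?C \<times> path_image (circlepath 0 1)) (\<lambda>(v, u). h (u, v) / u ^ Suc j / (v - w))"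
          using w_notin
          by (auto simp: case_prod_unfold intro!: continuous_intros
              continuous_on_compose2[OF holomorphic2_continuous[OF h, of UNIV]])
      qed (auto simp: vector_derivative_circlepath intro!: continuous_intros)
      also have "\<dots> = contour_integral (circlepath 0 1) (\<lambda>u. 2 * pi * \<i> * (h (u, w) / u ^ Suc j))"
      proof (intro contour_integral_cong refl)
        fix u
        have "((\<lambda>v. h (u, v) / (v - w)) has_contour_integral (2 * pi * \<i> * h (u, w))) ?C"
          using Cauchy_integral_circlepath_simple[OF hol2[of u], of w 0 R] w by simp
        from has_contour_integral_div[OF this, of "u ^ Suc j"]
        have "contour_integral ?C (\<lambda>v. h (u, v) / (v - w) / u ^ Suc j) = 2 * pi * \<i> * h (u, w) / u ^ Suc j"
          by (rule contour_integral_unique)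
        then show "contour_integral ?C (\<lambda>v. h (u, v) / u ^ Suc j / (v - w)) = 2 * pi * \<i> * (h (u, w) / u ^ Suc j)"
          by (simp add: mult_ac)
      qed
      also have "\<dots> = 2 * pi * \<i> * I j w"
        unfolding I_def
        by (intro contour_integral_lmul)
           (auto intro!: contour_integrable_continuous_circlepath continuous_intros
             holomorphic_on_imp_continuous_on[OF hol1])
      finally have eq: "contour_integral ?C (\<lambda>v. I j v / (v - w)) = 2 * pi * \<i> * I j w" .
      have "(\<lambda>v. I j v / (v - w)) contour_integrable_on ?C"
        using w_notin by (intro contour_integrable_continuous_circlepath continuous_intros
            continuous_on_subset[OF cont]) auto
      from has_contour_integral_integral[OF this] show ?thesis unfolding eq by simp
    qed
    \<comment> \<open>An integral of Cauchy type can be differentiated under the integral sign.\<close>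
    have "w0 \<in> ball 0 R" unfolding R_def by simp
    from Cauchy_next_derivative_circlepath(2)[OF continuous_on_subset[OF cont] I _ this]
    obtain d where "((\<lambda>w. 2 * pi * \<i> * I j w) has_field_derivative d) (at w0)" by auto
    from DERIV_cdivide[OF this, of "(2 * pi * \<i>)\<^sup>2"]
    moreover have "(\<lambda>w. 2 * pi * \<i> * I j w / (2 * pi * \<i>)\<^sup>2) = c j"
      by (simp add: fun_eq_iff c_def power2_eq_square)
    ultimately have "(c j has_field_derivative d / (2 * pi * \<i>)\<^sup>2) (at w0)" by simp
    then show "c j field_differentiable at w0 within UNIV" unfolding field_differentiable_def by auto
  qed
  have "expands h c (\<lambda>j k. (deriv ^^ k) (c j) 0 / fact k)"
    unfolding expands_def using c entire_power_series[OF hol] by blast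
  then show ?thesis by blast
qed

lemma expands_remove_box:
  assumes "expands h c a"
  shows "\<exists>c'. expands (\<lambda>p. h p - (\<Sum>(j, k)\<in>{..<N} \<times> {..<N}. a j k * (fst p ^ j * snd p ^ k))) c'
    (\<lambda>j k. if j < N \<and> k < N then 0 else a j k)"
proof -
  define q where "q j w = (if j < N then \<Sum>k<N. a j k * w ^ k else 0)" for j w
  have 1: "(\<lambda>k. (if j < N \<and> k < N then 0 else a j k) * w ^ k) sums (c j w - q j w)" for j w
  proof -
    have "(\<lambda>k. if k \<in> {..<N} then (if j < N then a j k * w ^ k else 0) else 0) sums
       (\<Sum>k<N. if j < N then a j k * w ^ k else 0)"
      by (rule sums_If_finite_set) auto
    also have "(\<Sum>k<N. if j < N then a j k * w ^ k else 0) = q j w" unfolding q_def by auto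
    finally have "(\<lambda>k. a j k * w ^ k - (if k \<in> {..<N} then (if j < N then a j k * w ^ k else 0) else 0)) sums (c j w - q j w)"
      using assms unfolding expands_def by (intro sums_diff) auto
    then show ?thesis by (rule sums_cong[THEN iffD1, rotated]) auto
  qed
  have 2: "(\<lambda>j. (c j w - q j w) * z ^ j) sums (h (z, w) - (\<Sum>(j, k)\<in>{..<N} \<times> {..<N}. a j k * (z ^ j * w ^ k)))" for z w
  proof -
    have "(\<lambda>j. if j \<in> {..<N} then q j w * z ^ j else 0) sums (\<Sum>j<N. q j w * z ^ j)"
      by (rule sums_If_finite_set) auto
    also have "(\<lambda>j. if j \<in> {..<N} then q j w * z ^ j else 0) = (\<lambda>j. q j w * z ^ j)"
      unfolding q_def by auto
    also have "(\<Sum>j<N. q j w * z ^ j) = (\<Sum>j<N. \<Sum>k<N. a j k * (z ^ j * w ^ k))"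
      unfolding q_def by (intro sum.cong refl) (auto simp: sum_distrib_right sum_distrib_left mult_ac)
    also have "\<dots> = (\<Sum>(j, k)\<in>{..<N} \<times> {..<N}. a j k * (z ^ j * w ^ k))"
      by (simp add: sum.cartesian_product)
    finally have "(\<lambda>j. c j w * z ^ j - q j w * z ^ j) sums (h (z, w) - \<dots>)"
      using assms unfolding expands_def by (intro sums_diff) auto
    then show ?thesis by (simp add: left_diff_distrib)
  qed
  show ?thesis unfolding expands_def using 1 2 by (intro exI[of _ "\<lambda>j w. c j w - q j w"]) auto
qed

section \<open>Averaging over tori\<close>

definition torus_act :: "complex \<Rightarrow> complex \<Rightarrow> c2 \<Rightarrow> c2" where
  "torus_act l r p = (l * fst p, r * snd p)"

lemma orthogonal_torus_act:
  assumes "cmod l = 1" "cmod r = 1"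
  shows "orthogonal_transformation (torus_act l r)"
  unfolding orthogonal_transformation torus_act_def
  using assms
  by (auto intro!: linearI simp: norm_Pair norm_mult norm_prod_def algebra_simps)

lemma continuous_on_torus_act: "continuous_on UNIV (torus_act l r)"
  unfolding torus_act_def by (intro continuous_intros)

lemma measurable_torus_act [measurable]: "torus_act l r \<in> borel_measurable borel"
  by (rule borel_measurable_continuous_onI[OF continuous_on_torus_act])

lemma nn_integral_torus_act:
  assumes "cmod l = 1" "cmod r = 1" and [measurable]: "F \<in> borel_measurable borel"
  shows "(\<integral>\<^sup>+p. F (torus_act l r p) \<partial>lborel) = (\<integral>\<^sup>+p. F p \<partial>lborel)"
proof -
  have "(\<integral>\<^sup>+p. F (torus_act l r p) \<partial>lborel) = (\<integral>\<^sup>+p. F p \<partial>distr lborel borel (torus_act l r))"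
    by (subst nn_integral_distr) auto
  then show ?thesis unfolding distr_lborel_orthogonal[OF orthogonal_torus_act[OF assms(1,2)]] .
qed

lemma integral_torus_act:
  fixes F :: "c2 \<Rightarrow> complex"
  assumes "cmod l = 1" "cmod r = 1" and [measurable]: "F \<in> borel_measurable borel"
  shows "(\<integral>p. F (torus_act l r p) \<partial>lborel) = (\<integral>p. F p \<partial>lborel)"
proof -
  have "(\<integral>p. F (torus_act l r p) \<partial>lborel) = (\<integral>p. F p \<partial>distr lborel borel (torus_act l r))"
    by (subst integral_distr) auto
  then show ?thesis unfolding distr_lborel_orthogonal[OF orthogonal_torus_act[OF assms(1,2)]] .
qed

lemma pair_sigma_finite_circle: "pair_sigma_finite (lborel :: c2 measure) circle"
  by (rule pair_sigma_finite.intro) (rule sigma_finite_lborel, rule circle.sigma_finite_measure_axioms)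

text \<open>Rotations preserve Lebesgue measure, so \<open>F\<close> may be replaced by its average over any one-parameter family of
  them. Rotating each coordinate separately gives the torus average; rotating both by the same angle
  gives averages over the circles \<open>\<zeta> w\<close>, \<open>\<bar>\<zeta>\<bar> = 1\<close>, on complex lines.\<close>

lemma nn_integral_average:
  fixes F :: "c2 \<Rightarrow> ennreal" and l r :: "real \<Rightarrow> complex"
  assumes [measurable]: "F \<in> borel_measurable borel" "l \<in> borel_measurable borel" "r \<in> borel_measurable borel"
    and lr: "\<And>t. cmod (l t) = 1" "\<And>t. cmod (r t) = 1"
  shows "(\<integral>\<^sup>+p. F p \<partial>lborel) = (\<integral>\<^sup>+p. \<integral>\<^sup>+t. F (torus_act (l t) (r t) p) \<partial>circle \<partial>lborel)"
    and "(\<lambda>p. \<integral>\<^sup>+t. F (torus_act (l t) (r t) p) \<partial>circle) \<in> borel_measurable borel"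
proof -
  interpret pair_sigma_finite "lborel :: c2 measure" circle by (rule pair_sigma_finite_circle)
  have "(\<lambda>q. torus_act (l (snd q)) (r (snd q)) (fst q)) \<in> borel_measurable ((borel :: c2 measure) \<Otimes>\<^sub>M (borel :: real measure))"
    unfolding torus_act_def borel_prod[symmetric] by measurable
  then have m: "(\<lambda>q. F (torus_act (l (snd q)) (r (snd q)) (fst q))) \<in> borel_measurable ((borel :: c2 measure) \<Otimes>\<^sub>M (borel :: real measure))"
    by measurable
  then have m': "(\<lambda>(p, t). F (torus_act (l t) (r t) p)) \<in> borel_measurable (lborel \<Otimes>\<^sub>M circle)"
    by (simp add: case_prod_unfold cong: measurable_cong_sets sets_pair_measure_cong add: sets_circle)
  have "(\<integral>\<^sup>+p. F p \<partial>lborel) = (\<integral>\<^sup>+t. \<integral>\<^sup>+p. F (torus_act (l t) (r t) p) \<partial>lborel \<partial>circle)"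
    using lr by (simp add: nn_integral_torus_act)
  also have "\<dots> = (\<integral>\<^sup>+p. \<integral>\<^sup>+t. F (torus_act (l t) (r t) p) \<partial>circle \<partial>lborel)"
    by (rule Fubini'[OF m'])
  finally show "(\<integral>\<^sup>+p. F p \<partial>lborel) = (\<integral>\<^sup>+p. \<integral>\<^sup>+t. F (torus_act (l t) (r t) p) \<partial>circle \<partial>lborel)" .
  show "(\<lambda>p. \<integral>\<^sup>+t. F (torus_act (l t) (r t) p) \<partial>circle) \<in> borel_measurable borel"
    using circle.borel_measurable_nn_integral_fst[OF m'] by simp
qed

lemma integral_average:
  fixes F :: "c2 \<Rightarrow> complex" and l r :: "real \<Rightarrow> complex"
  assumes F: "integrable lborel F" and [measurable]: "l \<in> borel_measurable borel" "r \<in> borel_measurable borel"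
    and lr: "\<And>t. cmod (l t) = 1" "\<And>t. cmod (r t) = 1"
  shows "(\<integral>p. F p \<partial>lborel) = (\<integral>p. \<integral>t. F (torus_act (l t) (r t) p) \<partial>circle \<partial>lborel)"
proof -
  interpret pair_sigma_finite "lborel :: c2 measure" circle by (rule pair_sigma_finite_circle)
  have [measurable]: "F \<in> borel_measurable borel" using borel_measurable_integrable[OF F] by simp
  have "(\<lambda>q. torus_act (l (snd q)) (r (snd q)) (fst q)) \<in> borel_measurable ((borel :: c2 measure) \<Otimes>\<^sub>M (borel :: real measure))"
    unfolding torus_act_def borel_prod[symmetric] by measurable
  then have m: "(\<lambda>q. F (torus_act (l (snd q)) (r (snd q)) (fst q))) \<in> borel_measurable ((borel :: c2 measure) \<Otimes>\<^sub>M (borel :: real measure))"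
    by measurable
  then have m'[measurable]: "(\<lambda>(p, t). F (torus_act (l t) (r t) p)) \<in> borel_measurable (lborel \<Otimes>\<^sub>M circle)"
    by (simp add: case_prod_unfold cong: measurable_cong_sets sets_pair_measure_cong add: sets_circle)
  have "(\<integral>\<^sup>+q. ennreal (norm (case q of (p, t) \<Rightarrow> F (torus_act (l t) (r t) p))) \<partial>(lborel \<Otimes>\<^sub>M circle)) =
    (\<integral>\<^sup>+p. \<integral>\<^sup>+t. ennreal (norm (F (torus_act (l t) (r t) p))) \<partial>circle \<partial>lborel)"
    by (subst circle.nn_integral_fst[symmetric]) auto
  also have "\<dots> = (\<integral>\<^sup>+p. ennreal (norm (F p)) \<partial>lborel)"
    using nn_integral_average(1)[of "\<lambda>p. ennreal (norm (F p))" l r] lr by simp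
  also have "\<dots> < \<infinity>" using F unfolding integrable_iff_bounded by simp
  finally have int: "integrable (lborel \<Otimes>\<^sub>M circle) (\<lambda>(p, t). F (torus_act (l t) (r t) p))"
    by (intro integrableI_bounded) auto
  have "(\<integral>p. F p \<partial>lborel) = (\<integral>t. \<integral>p. F (torus_act (l t) (r t) p) \<partial>lborel \<partial>circle)"
    using lr measure_circle by (simp add: integral_torus_act space_circle)
  also have "\<dots> = (\<integral>p. \<integral>t. F (torus_act (l t) (r t) p) \<partial>circle \<partial>lborel)"
    by (rule Fubini_integral[OF int])
  finally show ?thesis .
qed

lemma nn_integral_torus_average:
  assumes [measurable]: "F \<in> borel_measurable borel"
  shows "(\<integral>\<^sup>+p. F p \<partial>lborel) =
    (\<integral>\<^sup>+p. \<integral>\<^sup>+r. \<integral>\<^sup>+t. F (torus_act (turn t) (turn r) p) \<partial>circle \<partial>circle \<partial>lborel)"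
proof -
  have "torus_act (turn t) 1 (torus_act 1 (turn r) p) = torus_act (turn t) (turn r) p" for t r p
    by (simp add: torus_act_def)
  then show ?thesis
    using nn_integral_average(1)[of F turn "\<lambda>_. 1"] nn_integral_average(2)[of F turn "\<lambda>_. 1"]
      nn_integral_average(1)[of "\<lambda>p. \<integral>\<^sup>+t. F (torus_act (turn t) 1 p) \<partial>circle" "\<lambda>_. 1" turn]
    by simp
qed

definition monom2 :: "nat \<times> nat \<Rightarrow> c2 \<Rightarrow> complex" where
  "monom2 i p = fst p ^ fst i * snd p ^ snd i"

lemma holomorphic2_monom2: "holomorphic2 (monom2 i)"
  unfolding monom2_def[abs_def]
  by (intro holomorphic2_mult holomorphic2_power holomorphic2_fst holomorphic2_snd)

lemma monom2_torus_act: "monom2 i (torus_act l r p) = l ^ fst i * r ^ snd i * monom2 i p"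
  by (simp add: monom2_def torus_act_def power_mult_distrib)

section \<open>Monomials form an orthonormal basis\<close>

locale lebesgue_weight =
  fixes \<alpha> :: real and \<Phi> :: "c2 \<Rightarrow> real"
  assumes volume: "volume_measure \<Phi> = lborel"
    and continuous: "continuous_on UNIV \<Phi>"
begin

text \<open>The squared weighted norm, with values in \<open>[0, \<infinity>]\<close> so that Tonelli's theorem applies before
  finiteness is known.\<close>

definition nsq :: "(c2 \<Rightarrow> complex) \<Rightarrow> ennreal" where
  "nsq f = (\<integral>\<^sup>+p. ennreal (exp (- \<alpha> * \<Phi> p) * (cmod (f p))\<^sup>2) \<partial>lborel)"

lemma measurable_potential [measurable]: "\<Phi> \<in> borel_measurable borel"
  by (rule borel_measurable_continuous_onI[OF continuous])

lemma weighted_space_iff: "f \<in> weighted_space \<alpha> \<Phi> \<longleftrightarrow> holomorphic2 f \<and> nsq f < \<infinity>"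
proof -
  have "integrable lborel (\<lambda>p. exp (- \<alpha> * \<Phi> p) * (cmod (f p))\<^sup>2) \<longleftrightarrow> nsq f < \<infinity>" if "holomorphic2 f"
  proof -
    note [measurable] = holomorphic2_measurable[OF that]
    show ?thesis unfolding nsq_def integrable_iff_bounded by simp
  qed
  then show ?thesis unfolding weighted_space_def volume by auto
qed

lemma weighted_inner_self:
  assumes "holomorphic2 f"
  shows "weighted_inner \<alpha> \<Phi> f f = of_real (enn2real (nsq f))"
proof -
  note [measurable] = holomorphic2_measurable[OF assms]
  have "weighted_inner \<alpha> \<Phi> f f = (\<integral>p. of_real (exp (- \<alpha> * \<Phi> p) * (cmod (f p))\<^sup>2) \<partial>lborel)"
    unfolding weighted_inner_def volume by (simp add: complex_norm_square del: of_real_power)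
  also have "\<dots> = of_real (\<integral>p. exp (- \<alpha> * \<Phi> p) * (cmod (f p))\<^sup>2 \<partial>lborel)"
    by (rule integral_complex_of_real)
  also have "(\<integral>p. exp (- \<alpha> * \<Phi> p) * (cmod (f p))\<^sup>2 \<partial>lborel) = enn2real (nsq f)"
    unfolding nsq_def by (rule integral_eq_nn_integral) auto
  finally show ?thesis .
qed

lemma weighted_norm_eq: "holomorphic2 f \<Longrightarrow> weighted_norm \<alpha> \<Phi> f = sqrt (enn2real (nsq f))"
  unfolding weighted_norm_def by (simp add: weighted_inner_self)

lemma nsq_eq_0_imp:
  assumes f: "holomorphic2 f" and "nsq f = 0"
  shows "f p = 0"
proof (rule ccontr)
  assume p: "f p \<noteq> 0"
  note [measurable] = holomorphic2_measurable[OF f]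
  let ?U = "{p. f p \<noteq> 0}"
  have op: "open ?U"
    using holomorphic2_continuous[OF f, of UNIV] by (intro open_Collect_neq continuous_intros)
  have "AE p in lborel. ennreal (exp (- \<alpha> * \<Phi> p) * (cmod (f p))\<^sup>2) = 0"
    using assms(2) unfolding nsq_def by (subst (asm) nn_integral_0_iff_AE) auto
  then have "AE p in lborel. \<not> f p \<noteq> 0" by eventually_elim (auto simp: ennreal_eq_0_iff mult_le_0_iff)
  then have "?U \<in> null_sets lborel" using op by (subst AE_iff_null_sets) auto
  then have "negligible ?U"
    by (simp add: negligible_iff_null_sets null_sets_completionI)
  moreover have "?U \<noteq> {}" using p by blast
  ultimately show False using open_not_negligible[OF op] by blast
qed

end

locale torus_weight = lebesgue_weight +
  assumes invariant: "\<And>l r p. cmod l = 1 \<Longrightarrow> cmod r = 1 \<Longrightarrow> \<Phi> (torus_act l r p) = \<Phi> p"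
begin

text \<open>Since the weight is constant on tori, one may average \<open>\<bar>h\<bar>\<^sup>2\<close> over each torus first, where Parseval's identity
  evaluates it.\<close>

lemma nsq_expands:
  assumes h: "holomorphic2 h" and e: "expands h c a"
  shows "nsq h = (\<integral>\<^sup>+(j, k). ennreal ((cmod (a j k))\<^sup>2) * nsq (monom2 (j, k)) \<partial>count_space UNIV)"
proof -
  note [measurable] = holomorphic2_measurable[OF h] holomorphic2_measurable[OF holomorphic2_monom2]
  have c_meas [measurable]: "c j \<in> borel_measurable borel" for j
    by (rule borel_measurable_LIMSEQ_metric[where f = "\<lambda>n w. \<Sum>k<n. a j k * w ^ k"])
       (use e in \<open>auto simp: expands_def sums_def intro!: borel_measurable_continuous_onI continuous_intros\<close>)
  let ?w = "\<lambda>p. ennreal (exp (- \<alpha> * \<Phi> p))"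
  have circle: "(\<integral>\<^sup>+r. \<integral>\<^sup>+t. ennreal ((cmod (h (torus_act (turn t) (turn r) p)))\<^sup>2) \<partial>circle \<partial>circle) =
    (\<Sum>j. \<Sum>k. ennreal ((cmod (a j k))\<^sup>2) * ennreal ((cmod (monom2 (j, k) p))\<^sup>2))" for p
  proof -
    have "(\<integral>\<^sup>+r. \<integral>\<^sup>+t. ennreal ((cmod (h (torus_act (turn t) (turn r) p)))\<^sup>2) \<partial>circle \<partial>circle) =
      (\<integral>\<^sup>+r. (\<Sum>j. ennreal ((cmod (c j (turn r * snd p) * fst p ^ j))\<^sup>2)) \<partial>circle)"
      unfolding torus_act_def
      using e by (intro nn_integral_cong parseval_entire[where g = "\<lambda>z. h (z, w)" for w]) (auto simp: expands_def)
    also have "\<dots> = (\<Sum>j. \<integral>\<^sup>+r. ennreal ((cmod (c j (turn r * snd p) * fst p ^ j))\<^sup>2) \<partial>circle)"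
      by (rule nn_integral_suminf) measurable
    also have "\<dots> = (\<Sum>j. \<Sum>k. ennreal ((cmod (a j k * snd p ^ k * fst p ^ j))\<^sup>2))"
    proof (rule suminf_cong)
      fix j
      have "(\<integral>\<^sup>+r. ennreal ((cmod (c j (turn r * snd p) * fst p ^ j))\<^sup>2) \<partial>circle) =
         (\<integral>\<^sup>+r. ennreal ((cmod (c j (turn r * snd p)))\<^sup>2) * ennreal ((cmod (fst p ^ j))\<^sup>2) \<partial>circle)"
        by (simp add: norm_mult power_mult_distrib ennreal_mult)
      also have "\<dots> = (\<integral>\<^sup>+r. ennreal ((cmod (c j (turn r * snd p)))\<^sup>2) \<partial>circle) * ennreal ((cmod (fst p ^ j))\<^sup>2)"
        by (rule nn_integral_multc) measurable
      also have "(\<integral>\<^sup>+r. ennreal ((cmod (c j (turn r * snd p)))\<^sup>2) \<partial>circle) = (\<Sum>k. ennreal ((cmod (a j k * snd p ^ k))\<^sup>2))"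
        using e by (intro parseval_entire) (auto simp: expands_def)
      finally show "(\<integral>\<^sup>+r. ennreal ((cmod (c j (turn r * snd p) * fst p ^ j))\<^sup>2) \<partial>circle) =
         (\<Sum>k. ennreal ((cmod (a j k * snd p ^ k * fst p ^ j))\<^sup>2))"
        by (simp add: norm_mult power_mult_distrib ennreal_mult flip: ennreal_suminf_multc)
    qed
    also have "\<dots> = (\<Sum>j. \<Sum>k. ennreal ((cmod (a j k))\<^sup>2) * ennreal ((cmod (monom2 (j, k) p))\<^sup>2))"
      by (simp add: monom2_def norm_mult power_mult_distrib ennreal_mult mult_ac)
    finally show ?thesis .
  qed
  have "nsq h = (\<integral>\<^sup>+p. \<integral>\<^sup>+r. \<integral>\<^sup>+t. ennreal (exp (- \<alpha> * \<Phi> (torus_act (turn t) (turn r) p)) *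
      (cmod (h (torus_act (turn t) (turn r) p)))\<^sup>2) \<partial>circle \<partial>circle \<partial>lborel)"
    unfolding nsq_def by (rule nn_integral_torus_average) measurable
  also have "\<dots> = (\<integral>\<^sup>+p. ?w p * (\<integral>\<^sup>+r. \<integral>\<^sup>+t. ennreal ((cmod (h (torus_act (turn t) (turn r) p)))\<^sup>2) \<partial>circle \<partial>circle) \<partial>lborel)"
  proof (intro nn_integral_cong)
    fix p
    have "(\<integral>\<^sup>+r. \<integral>\<^sup>+t. ennreal (exp (- \<alpha> * \<Phi> (torus_act (turn t) (turn r) p)) *
      (cmod (h (torus_act (turn t) (turn r) p)))\<^sup>2) \<partial>circle \<partial>circle) =
      (\<integral>\<^sup>+r. ?w p * (\<integral>\<^sup>+t. ennreal ((cmod (h (torus_act (turn t) (turn r) p)))\<^sup>2) \<partial>circle) \<partial>circle)"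
      unfolding torus_act_def
      by (subst nn_integral_cmult[symmetric])
         (auto simp: ennreal_mult invariant[unfolded torus_act_def] intro!: borel_measurable_continuous_onI
            continuous_intros continuous_on_compose2[OF holomorphic2_continuous[OF h, of UNIV]])
    also have "\<dots> = ?w p * (\<integral>\<^sup>+r. \<integral>\<^sup>+t. ennreal ((cmod (h (torus_act (turn t) (turn r) p)))\<^sup>2) \<partial>circle \<partial>circle)"
    proof (rule nn_integral_cmult)
      have "(\<lambda>q. ennreal ((cmod (h (torus_act (turn (snd q)) (turn (fst q)) p)))\<^sup>2)) \<in> borel_measurable (borel \<Otimes>\<^sub>M borel)"
        unfolding torus_act_def borel_prod
        by (intro measurable_compose[OF _ measurable_ennreal] borel_measurable_continuous_onI
            continuous_intros continuous_on_compose2[OF holomorphic2_continuous[OF h, of UNIV]]) auto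
      then have "(\<lambda>(r, t). ennreal ((cmod (h (torus_act (turn t) (turn r) p)))\<^sup>2)) \<in> borel_measurable (circle \<Otimes>\<^sub>M circle)"
        by (simp add: case_prod_unfold cong: measurable_cong_sets sets_pair_measure_cong add: sets_circle)
      from circle.borel_measurable_nn_integral_fst[OF this]
      show "(\<lambda>r. \<integral>\<^sup>+t. ennreal ((cmod (h (torus_act (turn t) (turn r) p)))\<^sup>2) \<partial>circle) \<in> borel_measurable circle" by simp
    qed
    finally show "(\<integral>\<^sup>+r. \<integral>\<^sup>+t. ennreal (exp (- \<alpha> * \<Phi> (torus_act (turn t) (turn r) p)) *
      (cmod (h (torus_act (turn t) (turn r) p)))\<^sup>2) \<partial>circle \<partial>circle) = \<dots>" .
  qed
  also have "\<dots> = (\<integral>\<^sup>+p. (\<Sum>j. \<Sum>k. ennreal ((cmod (a j k))\<^sup>2) *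
      ennreal (exp (- \<alpha> * \<Phi> p) * (cmod (monom2 (j, k) p))\<^sup>2)) \<partial>lborel)"
    unfolding circle by (simp add: ennreal_mult mult_ac flip: ennreal_suminf_cmult)
  also have "\<dots> = (\<Sum>j. \<Sum>k. ennreal ((cmod (a j k))\<^sup>2) * nsq (monom2 (j, k)))"
    unfolding nsq_def
    by (subst nn_integral_suminf, measurable, intro suminf_cong, subst nn_integral_suminf, measurable,
        intro suminf_cong, rule nn_integral_cmult, measurable)
  also have "\<dots> = (\<integral>\<^sup>+(j, k). ennreal ((cmod (a j k))\<^sup>2) * nsq (monom2 (j, k)) \<partial>count_space UNIV)"
    by (simp add: nn_integral_count_space_nat flip: nn_integral_fst_count_space)
  finally show ?thesis .
qed

text \<open>If the exponents in one coordinate differ, some rotation of that coordinate multiplies the integrand by \<open>-1\<close>.\<close>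

lemma monom_inner_0:
  assumes "i \<noteq> i'"
  shows "weighted_inner \<alpha> \<Phi> (monom2 i) (monom2 i') = 0"
proof -
  let ?I = "weighted_inner \<alpha> \<Phi> (monom2 i) (monom2 i')"
  note [measurable] = holomorphic2_measurable[OF holomorphic2_monom2]
  have [measurable]: "(\<lambda>p. cnj (monom2 i' p)) \<in> borel_measurable borel"
    by (intro borel_measurable_continuous_onI continuous_on_cnj holomorphic2_continuous holomorphic2_monom2)
  have rot: "?I = l ^ fst i * r ^ snd i * cnj (l ^ fst i' * r ^ snd i') * ?I" if "cmod l = 1" "cmod r = 1" for l r
  proof -
    have "?I = (\<integral>p. of_real (exp (- \<alpha> * \<Phi> (torus_act l r p))) * (monom2 i (torus_act l r p) * cnj (monom2 i' (torus_act l r p))) \<partial>lborel)"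
      unfolding weighted_inner_def volume
      by (rule integral_torus_act[symmetric, OF that]) measurable
    also have "\<dots> = (\<integral>p. (l ^ fst i * r ^ snd i * cnj (l ^ fst i' * r ^ snd i')) *
       (of_real (exp (- \<alpha> * \<Phi> p)) * (monom2 i p * cnj (monom2 i' p))) \<partial>lborel)"
      unfolding invariant[OF that] monom2_torus_act by (simp add: mult_ac)
    also have "\<dots> = l ^ fst i * r ^ snd i * cnj (l ^ fst i' * r ^ snd i') * ?I"
      unfolding weighted_inner_def volume by (rule integral_mult_right_zero)
    finally show ?thesis .
  qed
  \<comment> \<open>The angle \<open>\<pi> / (j - k)\<close> is chosen so that the character \<open>l\<^sup>j\<^sup>-\<^sup>k\<close> takes the value \<open>-1\<close>.\<close>
  have half_turn: "\<exists>l. cmod l = 1 \<and> l ^ j * cnj (l ^ k) = -1" if "j \<noteq> k" for j k :: nat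
  proof -
    let ?x = "pi / (real j - real k)"
    have "cis ?x ^ j * cnj (cis ?x ^ k) = cis (real j * ?x - real k * ?x)"
      by (simp add: Complex.DeMoivre cis_cnj cis_mult)
    also have "real j * ?x - real k * ?x = pi"
      using that unfolding left_diff_distrib[symmetric] by simp
    finally show ?thesis by (intro exI[of _ "cis ?x"]) (simp add: cis_pi)
  qed
  consider "fst i \<noteq> fst i'" | "snd i \<noteq> snd i'" using assms by (auto simp: prod_eq_iff)
  then show ?thesis
  proof cases
    case 1
    then obtain l where l: "cmod l = 1" "l ^ fst i * cnj (l ^ fst i') = -1" using half_turn by blast
    have "?I = - ?I" using rot[of l 1] l by simp
    then show ?thesis by simp
  next
    case 2
    then obtain r where r: "cmod r = 1" "r ^ snd i * cnj (r ^ snd i') = -1" using half_turn by blast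
    have "?I = - ?I" using rot[of 1 r] r by simp
    then show ?thesis by simp
  qed
qed

lemma weighted_inner_scale:
  "weighted_inner \<alpha> \<Phi> (\<lambda>p. c * f p) (\<lambda>p. d * g p) = c * cnj d * weighted_inner \<alpha> \<Phi> f g"
proof -
  have "weighted_inner \<alpha> \<Phi> (\<lambda>p. c * f p) (\<lambda>p. d * g p) =
    (\<integral>p. (c * cnj d) * (of_real (exp (- \<alpha> * \<Phi> p)) * (f p * cnj (g p))) \<partial>volume_measure \<Phi>)"
    unfolding weighted_inner_def by (simp add: mult_ac)
  then show ?thesis unfolding weighted_inner_def by simp
qed

text \<open>If a monomial has infinite norm, its coefficient vanishes in every function of finite norm, by
  \<open>nsq_expands\<close>. The squared distance from such a function to its Taylor polynomial over the box
  \<open>j, k < N\<close> is a tail of a convergent sum and tends to 0.\<close>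

lemma ex_orthonormal_basis: "\<exists>B. orthonormal_basis \<alpha> \<Phi> B"
proof -
  define b where "b i p = of_real (1 / sqrt (enn2real (nsq (monom2 i)))) * monom2 i p" for i p
  define J where "J = {i. nsq (monom2 i) < \<infinity>}"
  have pos: "enn2real (nsq (monom2 i)) > 0" if "i \<in> J" for i
  proof -
    have "monom2 i (1, 1) \<noteq> 0" by (simp add: monom2_def)
    then have "nsq (monom2 i) \<noteq> 0" using nsq_eq_0_imp[OF holomorphic2_monom2] by blast
    then show ?thesis using that unfolding J_def by (auto simp: enn2real_positive_iff zero_less_iff_neq_zero)
  qed
  have b_fun: "b i = (\<lambda>p. of_real (1 / sqrt (enn2real (nsq (monom2 i)))) * monom2 i p)" for i
    by (simp add: b_def fun_eq_iff)
  have orth: "weighted_inner \<alpha> \<Phi> (b i) (b i') = (if i = i' then 1 else 0)" if "i \<in> J" "i' \<in> J" for i i'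
  proof (cases "i = i'")
    case True
    have "of_real (1 / sqrt (enn2real (nsq (monom2 i)))) * cnj (of_real (1 / sqrt (enn2real (nsq (monom2 i))))) *
       complex_of_real (enn2real (nsq (monom2 i))) = of_real (1 / sqrt (enn2real (nsq (monom2 i))) *
        (1 / sqrt (enn2real (nsq (monom2 i)))) * enn2real (nsq (monom2 i)))"
      by (simp only: of_real_mult complex_cnj_complex_of_real)
    also have "1 / sqrt (enn2real (nsq (monom2 i))) * (1 / sqrt (enn2real (nsq (monom2 i)))) *
        enn2real (nsq (monom2 i)) = 1" using pos[OF that(1)] by (simp add: field_simps)
    finally show ?thesis
      using True by (simp only: b_fun weighted_inner_scale weighted_inner_self[OF holomorphic2_monom2]) simp
  next
    case False
    then show ?thesis unfolding b_fun weighted_inner_scale by (simp add: monom_inner_0)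
  qed
  have inj: "b i = b i' \<longleftrightarrow> i = i'" if "i \<in> J" "i' \<in> J" for i i'
    using orth[of i i'] orth[of i i] that by (metis zero_neq_one)
  have b_hol: "holomorphic2 (b i)" for i
    unfolding b_fun by (intro holomorphic2_cmult holomorphic2_monom2)
  have "b i \<in> weighted_space \<alpha> \<Phi>" if "i \<in> J" for i
  proof -
    have "integrable lborel (\<lambda>p. exp (- \<alpha> * \<Phi> p) * (cmod (monom2 i p))\<^sup>2)"
      using that unfolding J_def using weighted_space_iff[of "monom2 i"] holomorphic2_monom2[of i]
      by (auto simp: weighted_space_def volume)
    then have "integrable lborel (\<lambda>p. (cmod (of_real (1 / sqrt (enn2real (nsq (monom2 i))))))\<^sup>2 *
       (exp (- \<alpha> * \<Phi> p) * (cmod (monom2 i p))\<^sup>2))"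
      by (rule integrable_mult_right)
    then show ?thesis
      using b_hol[of i] unfolding weighted_space_def volume mem_Collect_eq
      by (simp only: b_def norm_mult power_mult_distrib mult_ac simp_thms)
  qed
  moreover have "\<exists>F c. finite F \<and> F \<subseteq> b ` J \<and> weighted_norm \<alpha> \<Phi> (\<lambda>p. h p - (\<Sum>f\<in>F. c f * f p)) < \<epsilon>"
    if h: "h \<in> weighted_space \<alpha> \<Phi>" and \<epsilon>: "\<epsilon> > 0" for h \<epsilon>
  proof -
    have hol: "holomorphic2 h" and fin: "nsq h < \<infinity>" using h unfolding weighted_space_iff by auto
    obtain c a where e: "expands h c a" using holomorphic2_expands[OF hol] by blast
    define T where "T = (\<lambda>(j, k). ennreal ((cmod (a j k))\<^sup>2) * nsq (monom2 (j, k)))"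
    have T_fin: "(\<integral>\<^sup>+i. T i \<partial>count_space UNIV) < \<infinity>"
      using fin unfolding nsq_expands[OF hol e] T_def .
    have a0: "a (fst i) (snd i) = 0" if "i \<notin> J" for i
    proof (rule ccontr)
      assume "a (fst i) (snd i) \<noteq> 0"
      then have "T i = \<infinity>" using that unfolding T_def J_def by (auto simp: case_prod_unfold top_unique less_top[symmetric] ennreal_mult_eq_top_iff)
      moreover have "T i \<le> (\<integral>\<^sup>+i. T i \<partial>count_space UNIV)"
        by (rule nn_integral_ge_point) simp
      ultimately show False using T_fin by (simp add: top_unique)
    qed
    define box where "box N = {..<N} \<times> {..<N :: nat}" for N
    define g where "g N p = h p - (\<Sum>(j, k)\<in>box N. a j k * (fst p ^ j * snd p ^ k))" for N p
    have g_hol: "holomorphic2 (g N)" for N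
      unfolding g_def[abs_def] case_prod_unfold
      by (intro holomorphic2_diff hol holomorphic2_sum holomorphic2_cmult
          holomorphic2_mult holomorphic2_power holomorphic2_fst holomorphic2_snd)
    have "nsq (g N) = (\<integral>\<^sup>+i. (if i \<in> box N then 0 else T i) \<partial>count_space UNIV)" for N
    proof -
      obtain c' where "expands (g N) c' (\<lambda>j k. if j < N \<and> k < N then 0 else a j k)"
        using expands_remove_box[OF e] unfolding g_def box_def by blast
      from nsq_expands[OF g_hol this] show ?thesis
        by (auto simp: T_def box_def intro!: nn_integral_cong)
    qed
    moreover have "(\<lambda>N. \<integral>\<^sup>+i. (if i \<in> box N then 0 else T i) \<partial>count_space UNIV) \<longlonglongrightarrow> (\<integral>\<^sup>+i. 0 \<partial>count_space (UNIV :: (nat \<times> nat) set))"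
    proof (rule nn_integral_dominated_convergence[where w = T])
      have "(\<lambda>N. if i \<in> box N then 0 else T i) \<longlonglongrightarrow> 0" for i
        by (rule tendsto_eventually, rule eventually_sequentiallyI[of "Suc (max (fst i) (snd i))"])
           (auto simp: box_def mem_Times_iff)
      then show "AE i in count_space UNIV. (\<lambda>N. if i \<in> box N then 0 else T i) \<longlonglongrightarrow> 0" by simp
    qed (use T_fin in auto)
    ultimately have "(\<lambda>N. nsq (g N)) \<longlonglongrightarrow> 0" by simp
    moreover have "0 < ennreal (\<epsilon>\<^sup>2)" using \<epsilon> by simp
    ultimately obtain N where N: "nsq (g N) < ennreal (\<epsilon>\<^sup>2)"
      using order_tendstoD(2) eventually_sequentially by (metis order_refl)
    have "weighted_norm \<alpha> \<Phi> (g N) < \<epsilon>"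
    proof -
      have "enn2real (nsq (g N)) < \<epsilon>\<^sup>2"
        using N by (cases "nsq (g N)") (auto simp: ennreal_less_iff)
      then show ?thesis unfolding weighted_norm_eq[OF g_hol] using \<epsilon> real_sqrt_less_iff[of _ "\<epsilon>\<^sup>2"] by simp
    qed
    define s where "s i = of_real (sqrt (enn2real (nsq (monom2 i)))) * a (fst i) (snd i)" for i
    have "(\<Sum>(j, k)\<in>box N. a j k * (fst p ^ j * snd p ^ k)) = (\<Sum>f\<in>b ` (box N \<inter> J). s (inv_into J b f) * f p)" for p
    proof -
      have "inj_on b (box N \<inter> J)" using inj by (auto simp: inj_on_def)
      then have "(\<Sum>f\<in>b ` (box N \<inter> J). s (inv_into J b f) * f p) = (\<Sum>i\<in>box N \<inter> J. s (inv_into J b (b i)) * b i p)"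
        by (simp add: sum.reindex)
      also have "\<dots> = (\<Sum>i\<in>box N \<inter> J. a (fst i) (snd i) * (fst p ^ fst i * snd p ^ snd i))"
      proof (rule sum.cong[OF refl])
        fix i assume i: "i \<in> box N \<inter> J"
        have "inv_into J b (b i) = i" using i inj by (intro inv_into_f_f) (auto simp: inj_on_def)
        moreover have "sqrt (enn2real (nsq (monom2 i))) \<noteq> 0" using pos[of i] i by simp
        ultimately show "s (inv_into J b (b i)) * b i p = a (fst i) (snd i) * (fst p ^ fst i * snd p ^ snd i)"
          unfolding s_def b_def monom2_def by simp
      qed
      also have "\<dots> = (\<Sum>i\<in>box N. a (fst i) (snd i) * (fst p ^ fst i * snd p ^ snd i))"
        by (rule sum.mono_neutral_left) (use a0 in \<open>auto simp: box_def\<close>)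
      finally show ?thesis by (simp add: case_prod_unfold)
    qed
    then have "g N = (\<lambda>p. h p - (\<Sum>f\<in>b ` (box N \<inter> J). s (inv_into J b f) * f p))"
      unfolding g_def by auto
    with \<open>weighted_norm \<alpha> \<Phi> (g N) < \<epsilon>\<close>
    have "finite (b ` (box N \<inter> J)) \<and> b ` (box N \<inter> J) \<subseteq> b ` J \<and>
      weighted_norm \<alpha> \<Phi> (\<lambda>p. h p - (\<Sum>f\<in>b ` (box N \<inter> J). s (inv_into J b f) * f p)) < \<epsilon>"
      by (auto simp: box_def)
    then show ?thesis by (intro exI[of _ "b ` (box N \<inter> J)"] exI[of _ "\<lambda>f. s (inv_into J b f)"])
  qed
  ultimately have "orthonormal_basis \<alpha> \<Phi> (b ` J)"
    unfolding orthonormal_basis_def using orth inj by auto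
  then show ?thesis by blast
qed

end

section \<open>Parseval and reproducing kernels in the weighted space\<close>

context lebesgue_weight
begin

lemma integrable_inner:
  assumes "f \<in> weighted_space \<alpha> \<Phi>" "g \<in> weighted_space \<alpha> \<Phi>"
  shows "integrable lborel (\<lambda>p. of_real (exp (- \<alpha> * \<Phi> p)) * (f p * cnj (g p)))"
proof -
  have hol: "holomorphic2 f" "holomorphic2 g" using assms unfolding weighted_space_def by auto
  note [measurable] = holomorphic2_measurable[OF hol(1)]
  have [measurable]: "(\<lambda>p. cnj (g p)) \<in> borel_measurable borel"
    by (intro borel_measurable_continuous_onI continuous_on_cnj holomorphic2_continuous hol)
  have "integrable lborel (\<lambda>p. exp (- \<alpha> * \<Phi> p) * (cmod (f p))\<^sup>2 + exp (- \<alpha> * \<Phi> p) * (cmod (g p))\<^sup>2)"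
    using assms unfolding weighted_space_def volume by auto
  then show ?thesis
  proof (rule Bochner_Integration.integrable_bound)
    show "AE p in lborel. norm (of_real (exp (- \<alpha> * \<Phi> p)) * (f p * cnj (g p))) \<le>
      norm (exp (- \<alpha> * \<Phi> p) * (cmod (f p))\<^sup>2 + exp (- \<alpha> * \<Phi> p) * (cmod (g p))\<^sup>2)"
    proof (rule AE_I2)
      fix p
      have "2 * (cmod (f p) * cmod (g p)) \<le> (cmod (f p))\<^sup>2 + (cmod (g p))\<^sup>2"
        using sum_squares_bound[of "cmod (f p)" "cmod (g p)"] by simp
      moreover have "0 \<le> cmod (f p) * cmod (g p)" by simp
      ultimately have "cmod (f p) * cmod (g p) \<le> (cmod (f p))\<^sup>2 + (cmod (g p))\<^sup>2" by linarith
      then have "exp (- \<alpha> * \<Phi> p) * (cmod (f p) * cmod (g p)) \<le> exp (- \<alpha> * \<Phi> p) * ((cmod (f p))\<^sup>2 + (cmod (g p))\<^sup>2)"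
        by (rule mult_left_mono) simp
      then show "norm (of_real (exp (- \<alpha> * \<Phi> p)) * (f p * cnj (g p))) \<le>
        norm (exp (- \<alpha> * \<Phi> p) * (cmod (f p))\<^sup>2 + exp (- \<alpha> * \<Phi> p) * (cmod (g p))\<^sup>2)"
        by (simp add: norm_mult distrib_left)
    qed
  qed measurable
qed

lemma weighted_inner_cnj: "weighted_inner \<alpha> \<Phi> g f = cnj (weighted_inner \<alpha> \<Phi> f g)"
proof -
  have "of_real w * (g p * cnj (f p)) = cnj (of_real w * (f p * cnj (g p)))" for w p by simp
  then show ?thesis unfolding weighted_inner_def by (simp only: Bochner_Integration.integral_cnj)
qed

lemma weighted_space_linear:
  assumes "f \<in> weighted_space \<alpha> \<Phi>" "g \<in> weighted_space \<alpha> \<Phi>"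
  shows "(\<lambda>p. f p + c * g p) \<in> weighted_space \<alpha> \<Phi>"
proof -
  have hol: "holomorphic2 f" "holomorphic2 g" using assms unfolding weighted_space_def by auto
  then have h: "holomorphic2 (\<lambda>p. f p + c * g p)" by (intro holomorphic2_add holomorphic2_cmult)
  note [measurable] = holomorphic2_measurable[OF h]
  have "integrable lborel (\<lambda>p. 2 * (exp (- \<alpha> * \<Phi> p) * (cmod (f p))\<^sup>2) + (2 * (cmod c)\<^sup>2) * (exp (- \<alpha> * \<Phi> p) * (cmod (g p))\<^sup>2))"
    using assms unfolding weighted_space_def volume by auto
  then have "integrable lborel (\<lambda>p. exp (- \<alpha> * \<Phi> p) * (cmod (f p + c * g p))\<^sup>2)"
  proof (rule Bochner_Integration.integrable_bound)
    show "AE p in lborel. norm (exp (- \<alpha> * \<Phi> p) * (cmod (f p + c * g p))\<^sup>2) \<le>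
      norm (2 * (exp (- \<alpha> * \<Phi> p) * (cmod (f p))\<^sup>2) + (2 * (cmod c)\<^sup>2) * (exp (- \<alpha> * \<Phi> p) * (cmod (g p))\<^sup>2))"
    proof (rule AE_I2)
      fix p
      have "(cmod (f p + c * g p))\<^sup>2 \<le> (cmod (f p) + cmod (c * g p))\<^sup>2"
        by (intro power_mono norm_triangle_ineq) auto
      also have "\<dots> \<le> 2 * (cmod (f p))\<^sup>2 + 2 * (cmod (c * g p))\<^sup>2"
        using sum_squares_bound[of "cmod (f p)" "cmod (c * g p)"] by (simp add: power2_sum)
      finally have "exp (- \<alpha> * \<Phi> p) * (cmod (f p + c * g p))\<^sup>2 \<le>
        exp (- \<alpha> * \<Phi> p) * (2 * (cmod (f p))\<^sup>2 + 2 * (cmod (c * g p))\<^sup>2)" by (rule mult_left_mono) simp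
      also have "\<dots> = 2 * (exp (- \<alpha> * \<Phi> p) * (cmod (f p))\<^sup>2) + (2 * (cmod c)\<^sup>2) * (exp (- \<alpha> * \<Phi> p) * (cmod (g p))\<^sup>2)"
        by (simp add: norm_mult power_mult_distrib algebra_simps)
      finally show "norm (exp (- \<alpha> * \<Phi> p) * (cmod (f p + c * g p))\<^sup>2) \<le>
        norm (2 * (exp (- \<alpha> * \<Phi> p) * (cmod (f p))\<^sup>2) + (2 * (cmod c)\<^sup>2) * (exp (- \<alpha> * \<Phi> p) * (cmod (g p))\<^sup>2))"
        by simp
    qed
  qed measurable
  then show ?thesis using h unfolding weighted_space_def volume by simp
qed

lemma weighted_inner_linear:
  assumes "f \<in> weighted_space \<alpha> \<Phi>" "g \<in> weighted_space \<alpha> \<Phi>" "k \<in> weighted_space \<alpha> \<Phi>"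
  shows "weighted_inner \<alpha> \<Phi> (\<lambda>p. f p + c * g p) k = weighted_inner \<alpha> \<Phi> f k + c * weighted_inner \<alpha> \<Phi> g k"
proof -
  have "weighted_inner \<alpha> \<Phi> (\<lambda>p. f p + c * g p) k =
    (\<integral>p. of_real (exp (- \<alpha> * \<Phi> p)) * (f p * cnj (k p)) + c * (of_real (exp (- \<alpha> * \<Phi> p)) * (g p * cnj (k p))) \<partial>lborel)"
    unfolding weighted_inner_def volume by (simp add: algebra_simps)
  also have "\<dots> = weighted_inner \<alpha> \<Phi> f k + c * weighted_inner \<alpha> \<Phi> g k"
    unfolding weighted_inner_def volume
    using integrable_inner[OF assms(1,3)] integrable_inner[OF assms(2,3)] by simp
  finally show ?thesis .
qed

text \<open>The Pythagorean identity for an arbitrary linear combination of basis vectors: it shows at the same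
  time Bessel's inequality (for \<open>c f = \<langle>k, f\<rangle>\<close>) and that no other choice of coefficients approximates better.\<close>

lemma weighted_norm_residual:
  fixes c :: "(c2 \<Rightarrow> complex) \<Rightarrow> complex"
  assumes B: "orthonormal_basis \<alpha> \<Phi> B" and k: "k \<in> weighted_space \<alpha> \<Phi>" and F: "finite F" "F \<subseteq> B"
  defines "q \<equiv> \<lambda>p. k p - (\<Sum>f\<in>F. c f * f p)"
  shows "q \<in> weighted_space \<alpha> \<Phi>"
    and "f \<in> B \<Longrightarrow> weighted_inner \<alpha> \<Phi> q f = weighted_inner \<alpha> \<Phi> k f - (if f \<in> F then c f else 0)"
    and "Re (weighted_inner \<alpha> \<Phi> q q) = Re (weighted_inner \<alpha> \<Phi> k k) - (\<Sum>f\<in>F. (cmod (weighted_inner \<alpha> \<Phi> k f))\<^sup>2)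
      + (\<Sum>f\<in>F. (cmod (weighted_inner \<alpha> \<Phi> k f - c f))\<^sup>2)"
proof -
  let ?ip = "weighted_inner \<alpha> \<Phi>"
  have mem: "f \<in> weighted_space \<alpha> \<Phi>" if "f \<in> B" for f using B that unfolding orthonormal_basis_def by auto
  have on: "?ip f g = (if f = g then 1 else 0)" if "f \<in> B" "g \<in> B" for f g
    using B that unfolding orthonormal_basis_def by auto
  have "q \<in> weighted_space \<alpha> \<Phi> \<and> (\<forall>f\<in>B. ?ip q f = ?ip k f - (if f \<in> F then c f else 0)) \<and>
    Re (?ip q q) = Re (?ip k k) - (\<Sum>f\<in>F. (cmod (?ip k f))\<^sup>2) + (\<Sum>f\<in>F. (cmod (?ip k f - c f))\<^sup>2)"
    using F unfolding q_def
  proof (induction F rule: finite_induct)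
    case empty
    then show ?case using k by simp
  next
    case (insert g F)
    let ?q = "\<lambda>p. k p - (\<Sum>f\<in>F. c f * f p)" and ?q' = "\<lambda>p. k p - (\<Sum>f\<in>insert g F. c f * f p)"
    have g: "g \<in> B" and gF: "g \<notin> F" using insert by auto
    have eq: "?q' = (\<lambda>p. ?q p + (- c g) * g p)" using insert.hyps by (auto simp: fun_eq_iff)
    have IH: "?q \<in> weighted_space \<alpha> \<Phi>" "\<And>f. f \<in> B \<Longrightarrow> ?ip ?q f = ?ip k f - (if f \<in> F then c f else 0)"
      "Re (?ip ?q ?q) = Re (?ip k k) - (\<Sum>f\<in>F. (cmod (?ip k f))\<^sup>2) + (\<Sum>f\<in>F. (cmod (?ip k f - c f))\<^sup>2)"
      using insert.IH insert.prems by auto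
    have 1: "?q' \<in> weighted_space \<alpha> \<Phi>"
      unfolding eq by (intro weighted_space_linear IH(1) mem g)
    have 2: "?ip ?q' f = ?ip k f - (if f \<in> insert g F then c f else 0)" if "f \<in> B" for f
      unfolding eq weighted_inner_linear[OF IH(1) mem[OF g] mem[OF that]] IH(2)[OF that] on[OF g that]
      using gF by auto
    have "?ip ?q' ?q' = ?ip ?q ?q' + (- c g) * ?ip g ?q'"
      using weighted_inner_linear[OF IH(1) mem[OF g] 1, of "- c g"] unfolding eq[symmetric] .
    also have "?ip ?q ?q' = cnj (?ip ?q' ?q)" by (rule weighted_inner_cnj)
    also have "?ip ?q' ?q = ?ip ?q ?q + (- c g) * ?ip g ?q"
      unfolding eq by (rule weighted_inner_linear[OF IH(1) mem[OF g] IH(1)])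
    also have "?ip g ?q = cnj (?ip ?q g)" by (rule weighted_inner_cnj)
    also have "?ip ?q g = ?ip k g" using IH(2)[OF g] gF by simp
    also have "?ip g ?q' = cnj (?ip ?q' g)" by (rule weighted_inner_cnj)
    also have "?ip ?q' g = ?ip k g - c g" using 2[OF g] by simp
    finally have E: "?ip ?q' ?q' = cnj (?ip ?q ?q + (- c g) * cnj (?ip k g)) + (- c g) * cnj (?ip k g - c g)" .
    have "Re (?ip ?q' ?q') = Re (?ip ?q ?q) - (cmod (?ip k g))\<^sup>2 + (cmod (?ip k g - c g))\<^sup>2"
      unfolding E cmod_power2 by (simp add: power2_eq_square algebra_simps)
    then have 3: "Re (?ip ?q' ?q') = Re (?ip k k) - (\<Sum>f\<in>insert g F. (cmod (?ip k f))\<^sup>2) + (\<Sum>f\<in>insert g F. (cmod (?ip k f - c f))\<^sup>2)"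
      unfolding IH(3) using insert.hyps by simp
    show ?case using 1 2 3 by blast
  qed
  then show "q \<in> weighted_space \<alpha> \<Phi>"
    and "f \<in> B \<Longrightarrow> ?ip q f = ?ip k f - (if f \<in> F then c f else 0)"
    and "Re (?ip q q) = Re (?ip k k) - (\<Sum>f\<in>F. (cmod (?ip k f))\<^sup>2) + (\<Sum>f\<in>F. (cmod (?ip k f - c f))\<^sup>2)"
    by auto
qed

lemma weighted_inner_self_nonneg: "f \<in> weighted_space \<alpha> \<Phi> \<Longrightarrow> 0 \<le> Re (weighted_inner \<alpha> \<Phi> f f)"
  using weighted_inner_self[of f] by (simp add: weighted_space_def)

lemma parseval_orthonormal_basis:
  assumes B: "orthonormal_basis \<alpha> \<Phi> B" and k: "k \<in> weighted_space \<alpha> \<Phi>"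
  shows "((\<lambda>f. (cmod (weighted_inner \<alpha> \<Phi> k f))\<^sup>2) has_sum Re (weighted_inner \<alpha> \<Phi> k k)) B"
proof -
  let ?ip = "weighted_inner \<alpha> \<Phi>" and ?s = "\<lambda>f. (cmod (weighted_inner \<alpha> \<Phi> k f))\<^sup>2"
  have bessel: "sum ?s F \<le> Re (?ip k k)" if "finite F" "F \<subseteq> B" for F
    using weighted_inner_self_nonneg[OF weighted_norm_residual(1)[OF B k that, of "?ip k"]]
    unfolding weighted_norm_residual(3)[OF B k that] by simp
  then have sm: "?s summable_on B"
    by (intro nonneg_bdd_above_summable_on) (auto simp: bdd_above_def)
  have "infsum ?s B \<le> Re (?ip k k)"
    by (rule infsum_le_finite_sums[OF sm]) (use bessel in auto)
  moreover have "Re (?ip k k) \<le> infsum ?s B + e" if e: "e > 0" for e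
  proof -
    obtain F c where F: "finite F" "F \<subseteq> B"
      and "weighted_norm \<alpha> \<Phi> (\<lambda>p. k p - (\<Sum>f\<in>F. c f * f p)) < sqrt e"
      using B k that unfolding orthonormal_basis_def using real_sqrt_gt_zero[OF e] by blast
    then have "Re (?ip k k) - sum ?s F + (\<Sum>f\<in>F. (cmod (?ip k f - c f))\<^sup>2) < e"
      unfolding weighted_norm_def weighted_norm_residual(3)[OF B k F] by simp
    moreover have "0 \<le> (\<Sum>f\<in>F. (cmod (?ip k f - c f))\<^sup>2)" by (intro sum_nonneg) auto
    moreover have "sum ?s F \<le> infsum ?s B" by (rule finite_sum_le_infsum[OF sm F]) auto
    ultimately show ?thesis by linarith
  qed
  then have "Re (?ip k k) \<le> infsum ?s B" by (rule field_le_epsilon)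
  ultimately have "infsum ?s B = Re (?ip k k)" by linarith
  then show ?thesis using has_sum_infsum[OF sm] by simp
qed

text \<open>A function that reproduces the value at \<open>x\<close> has \<open>f x\<close> as its coefficients, up to conjugation. Hence the kernel
  on the diagonal is the same for every orthonormal basis.\<close>

lemma reproducing_kernel_has_sum:
  assumes B: "orthonormal_basis \<alpha> \<Phi> B" and k: "k \<in> weighted_space \<alpha> \<Phi>"
    and rep: "\<And>f. f \<in> weighted_space \<alpha> \<Phi> \<Longrightarrow> weighted_inner \<alpha> \<Phi> f k = f x"
  shows "((\<lambda>f. f x * cnj (f x)) has_sum of_real (Re (k x))) B"
proof -
  have "(cmod (weighted_inner \<alpha> \<Phi> k f))\<^sup>2 = (cmod (f x))\<^sup>2" if "f \<in> B" for f
  proof -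
    have "f \<in> weighted_space \<alpha> \<Phi>" using B that unfolding orthonormal_basis_def by blast
    from rep[OF this] show ?thesis by (subst weighted_inner_cnj) simp
  qed
  then have "((\<lambda>f. (cmod (f x))\<^sup>2) has_sum Re (k x)) B"
    using parseval_orthonormal_basis[OF B k] unfolding rep[OF k] by (simp cong: has_sum_cong)
  from has_sum_of_real[OF this, where 'a = complex]
  show ?thesis unfolding complex_norm_square .
qed

end

section \<open>The Gaussian weight is balanced\<close>

definition herm :: "c2 \<Rightarrow> c2 \<Rightarrow> complex" where
  "herm p q = fst p * cnj (fst q) + snd p * cnj (snd q)"

lemma norm_add_herm: "(norm (x + w :: c2))\<^sup>2 = (norm x)\<^sup>2 + (norm w)\<^sup>2 + 2 * Re (herm w x)"
proof -
  have n: "(norm (p :: c2))\<^sup>2 = sq1 p + sq2 p" for p by (cases p) (simp add: norm_Pair)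
  show ?thesis unfolding n cmod_power2 herm_def by (simp add: power2_eq_square algebra_simps)
qed

lemma herm_self: "herm x x = of_real ((norm x)\<^sup>2)"
  by (cases x) (simp add: herm_def norm_Pair complex_norm_square del: of_real_power)

lemma holomorphic2_exp_herm: "holomorphic2 (\<lambda>p. exp (c * herm p x))"
proof (rule holomorphic2_compose[of _ exp])
  show "holomorphic2 (\<lambda>p. c * herm p x)" unfolding herm_def
    by (intro holomorphic2_mult holomorphic2_const holomorphic2_add holomorphic2_fst holomorphic2_snd)
qed (auto intro: holomorphic_intros)

lemma integrable_lborel_translate:
  fixes f :: "c2 \<Rightarrow> complex"
  assumes "integrable lborel f"
  shows "integrable lborel (\<lambda>x. f (c + x))" "(\<integral>x. f (c + x) \<partial>lborel) = (\<integral>x. f x \<partial>lborel)"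
proof -
  have m: "f \<in> borel_measurable borel" using borel_measurable_integrable[OF assms] by simp
  have "integrable (distr lborel borel ((+) c)) f" using assms by (simp add: lborel_distr_plus)
  then show "integrable lborel (\<lambda>x. f (c + x))" by (subst (asm) integrable_distr_eq) (use m in auto)
  have "(\<integral>x. f (c + x) \<partial>lborel) = (\<integral>x. f x \<partial>distr lborel borel ((+) c))"
    by (subst integral_distr) (use m in auto)
  then show "(\<integral>x. f (c + x) \<partial>lborel) = (\<integral>x. f x \<partial>lborel)" by (simp add: lborel_distr_plus)
qed

locale gaussian_weight = lebesgue_weight +
  assumes norm_sq: "\<And>p. \<Phi> p = (norm p)\<^sup>2" and \<alpha>_pos: "\<alpha> > 0"
begin

definition mass :: real where
  "mass = (\<integral>p. exp (- \<alpha> * (norm (p :: c2))\<^sup>2) \<partial>lborel)"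

lemma mass_pos: "mass > 0"
proof -
  have "mass = enn2real (nsq (\<lambda>_. 1))"
    unfolding mass_def nsq_def norm_sq by (subst integral_eq_nn_integral) auto
  moreover have "nsq (\<lambda>_. 1) < \<infinity>"
    using integrable_gaussian[OF \<alpha>_pos, where 'a = c2] unfolding nsq_def norm_sq integrable_iff_bounded by simp
  moreover have "nsq (\<lambda>_. 1) \<noteq> 0" using nsq_eq_0_imp[OF holomorphic2_const[of 1]] by auto
  ultimately show ?thesis by (auto simp: enn2real_positive_iff zero_less_iff_neq_zero)
qed

definition gkernel :: "c2 \<Rightarrow> c2 \<Rightarrow> complex" where
  "gkernel x p = of_real (1 / mass) * exp (of_real \<alpha> * herm p x)"

text \<open>Completing the square shows that the weighted square of the kernel function is a constant multiple of a
  translated Gaussian.\<close>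

lemma gkernel_in_weighted_space: "gkernel x \<in> weighted_space \<alpha> \<Phi>"
proof -
  have hol: "holomorphic2 (gkernel x)"
    unfolding gkernel_def[abs_def] by (intro holomorphic2_cmult holomorphic2_exp_herm)
  have eq: "exp (- \<alpha> * \<Phi> p) * (cmod (gkernel x p))\<^sup>2 =
    ((1 / mass)\<^sup>2 * exp (\<alpha> * (norm x)\<^sup>2)) * exp (- \<alpha> * (norm (p - x))\<^sup>2)" for p
  proof -
    have n: "(norm p)\<^sup>2 = (norm x)\<^sup>2 + (norm (p - x))\<^sup>2 + 2 * Re (herm (p - x) x)"
      using norm_add_herm[of x "p - x"] by simp
    have h: "herm p x = of_real ((norm x)\<^sup>2) + herm (p - x) x"
      unfolding herm_self[symmetric] by (simp add: herm_def algebra_simps)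
    have "(cmod (gkernel x p))\<^sup>2 = (1 / mass)\<^sup>2 * exp (2 * \<alpha> * Re (herm p x))"
      unfolding gkernel_def norm_mult power_mult_distrib norm_of_real power2_abs
      by (simp add: mult.assoc flip: exp_of_nat_mult)
    then show ?thesis unfolding norm_sq n h by (simp add: algebra_simps flip: exp_add)
  qed
  have "integrable lborel (\<lambda>p. exp (- \<alpha> * (norm (- x + p))\<^sup>2))"
  proof -
    have "integrable (distr lborel borel ((+) (- x))) (\<lambda>p. exp (- \<alpha> * (norm p)\<^sup>2))"
      using integrable_gaussian[OF \<alpha>_pos] by (simp add: lborel_distr_plus)
    then show ?thesis by (subst (asm) integrable_distr_eq) auto
  qed
  then have "integrable lborel (\<lambda>p. exp (- \<alpha> * (norm (p - x))\<^sup>2))" by simp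
  then show ?thesis
    using hol unfolding weighted_space_def volume mem_Collect_eq eq by simp
qed

text \<open>After the substitution \<open>p = x + w\<close> the integrand is a Gaussian in \<open>w\<close> times the holomorphic function
  \<open>G w = h (x + w) e\<^bsup>-\<alpha>\<langle>w,x\<rangle>\<^esup>\<close>. The average of \<open>G\<close> over the circle through \<open>w\<close> is \<open>G 0 = h x\<close>.\<close>

lemma gkernel_reproducing:
  assumes h: "h \<in> weighted_space \<alpha> \<Phi>"
  shows "weighted_inner \<alpha> \<Phi> h (gkernel x) = h x"
proof -
  have hol: "holomorphic2 h" using h unfolding weighted_space_def by simp
  define G where "G w = h (x + w) * exp (of_real (- \<alpha>) * herm w x)" for w
  have G_hol: "holomorphic2 G"
    unfolding G_def[abs_def] by (intro holomorphic2_mult holomorphic2_translate[OF hol] holomorphic2_exp_herm)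
  let ?w = "\<lambda>w :: c2. complex_of_real (exp (- \<alpha> * (norm w)\<^sup>2))"
  let ?I = "\<lambda>p. of_real (exp (- \<alpha> * \<Phi> p)) * (h p * cnj (gkernel x p))"
  have shift: "?I (x + w) = of_real (1 / mass) * (?w w * G w)" for w
  proof -
    have *: "cnj (herm (x + w) x) = of_real ((norm x)\<^sup>2) + cnj (herm w x)"
      unfolding herm_self[symmetric] by (simp add: herm_def algebra_simps)
    have e: "complex_of_real (- \<alpha> * \<Phi> (x + w)) + \<alpha> * cnj (herm (x + w) x) =
       of_real (- \<alpha> * (norm w)\<^sup>2) + of_real (- \<alpha>) * herm w x"
    proof -
      define a b where "a = (norm x)\<^sup>2" and "b = (norm w)\<^sup>2"
      show ?thesis
        unfolding norm_sq norm_add_herm * a_def[symmetric] b_def[symmetric]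
        by (simp add: complex_eq_iff algebra_simps)
    qed
    have "of_real (exp (- \<alpha> * \<Phi> (x + w))) * exp (\<alpha> * cnj (herm (x + w) x)) =
      ?w w * exp (of_real (- \<alpha>) * herm w x)"
      unfolding exp_of_real[symmetric] exp_add[symmetric] e ..
    then show ?thesis unfolding gkernel_def G_def by (simp add: exp_cnj mult_ac)
  qed
  have "integrable lborel ?I" by (rule integrable_inner[OF h gkernel_in_weighted_space])
  note tr = integrable_lborel_translate[OF this, of x, unfolded shift]
  have "weighted_inner \<alpha> \<Phi> h (gkernel x) = (\<integral>w. of_real (1 / mass) * (?w w * G w) \<partial>lborel)"
    unfolding weighted_inner_def volume using tr(2) by simp
  also have "\<dots> = of_real (1 / mass) * (\<integral>w. ?w w * G w \<partial>lborel)"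
    by (rule integral_mult_right_zero)
  also have "(\<integral>w. ?w w * G w \<partial>lborel) = (\<integral>w. \<integral>t. ?w (torus_act (turn t) (turn t) w) * G (torus_act (turn t) (turn t) w) \<partial>circle \<partial>lborel)"
  proof (rule integral_average)
    have "integrable lborel (\<lambda>w. of_real mass * (of_real (1 / mass) * (?w w * G w)))"
      using tr(1) by (rule integrable_mult_right)
    then show "integrable lborel (\<lambda>w. ?w w * G w)" using mass_pos by simp
  qed auto
  also have "\<dots> = (\<integral>w. ?w w * G 0 \<partial>lborel)"
  proof (rule Bochner_Integration.integral_cong[OF refl])
    fix w
    have "norm (torus_act (turn t) (turn t) w) = norm w" for t
      by (rule orthogonal_transformation_norm[OF orthogonal_torus_act]) auto
    then have "(\<integral>t. ?w (torus_act (turn t) (turn t) w) * G (torus_act (turn t) (turn t) w) \<partial>circle) =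
      ?w w * (\<integral>t. G (turn t * fst w, turn t * snd w) \<partial>circle)"
      by (simp add: torus_act_def)
    also have "(\<integral>t. G (turn t * fst w, turn t * snd w) \<partial>circle) = G 0"
    proof -
      have "(\<lambda>\<zeta>. G (\<zeta> * fst w, \<zeta> * snd w)) holomorphic_on UNIV"
        using holomorphic2_line[OF G_hol, of 0 "fst w" 0 "snd w" UNIV] by simp
      from mean_entire[OF entire_power_series[OF this], of 1] show ?thesis by (simp add: zero_prod_def)
    qed
    finally show "(\<integral>t. ?w (torus_act (turn t) (turn t) w) * G (torus_act (turn t) (turn t) w) \<partial>circle) = ?w w * G 0" .
  qed
  also have "\<dots> = of_real mass * G 0"
    unfolding mass_def integral_complex_of_real[symmetric] by (rule integral_mult_left_zero)
  also have "G 0 = h x" by (simp add: G_def herm_def)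
  finally show ?thesis using mass_pos by simp
qed

lemma epsilon_const:
  assumes ex: "\<exists>B. orthonormal_basis \<alpha> \<Phi> B"
  shows "epsilon_fun \<alpha> \<Phi> x = 1 / mass"
proof -
  have B: "orthonormal_basis \<alpha> \<Phi> (SOME B. orthonormal_basis \<alpha> \<Phi> B)" using ex by (rule someI_ex)
  have "weighted_kernel \<alpha> \<Phi> x x = of_real (Re (gkernel x x))"
    unfolding weighted_kernel_def
    by (rule infsumI, rule reproducing_kernel_has_sum[OF B gkernel_in_weighted_space gkernel_reproducing])
  moreover have "gkernel x x = of_real (1 / mass * exp (\<alpha> * (norm x)\<^sup>2))"
    unfolding gkernel_def herm_self by (simp add: exp_of_real[symmetric])
  ultimately show ?thesis
    unfolding epsilon_fun_def norm_sq by (simp flip: exp_add)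
qed

lemma balanced_gaussian:
  assumes "\<exists>B. orthonormal_basis \<alpha> \<Phi> B"
  shows "balanced \<alpha> \<Phi>"
  unfolding balanced_def
proof
  have "gkernel 0 0 \<noteq> 0" unfolding gkernel_def using mass_pos by simp
  then show "weighted_space \<alpha> \<Phi> \<noteq> {\<lambda>_. 0}" using gkernel_in_weighted_space[of 0] by auto
  show "\<exists>c>0. \<forall>x. epsilon_fun \<alpha> \<Phi> x = c"
    using epsilon_const[OF assms] mass_pos by (intro exI[of _ "1 / mass"]) auto
qed

end

section \<open>The kernel on an axis is entire\<close>

context torus_weight
begin

text \<open>Integrating \<open>\<Sum>\<bar>f(z, 0)\<bar>\<^sup>2\<close> over circles replaces it by a power series in \<open>\<bar>z\<bar>\<^sup>2\<close>, whose coefficients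
  are sums of squared Taylor coefficients over the basis. The exchange of sum and integral requires
  countably many terms. Only countably many basis functions are nonzero somewhere on the axis: each of them is nonzero at
  some point of a countable dense set, and at each point the sum of squares converges.\<close>

lemma kernel_axis_entire:
  assumes B: "orthonormal_basis \<alpha> \<Phi> B"
    and c: "\<And>x. exp (- \<alpha> * \<Phi> x) * Re (\<Sum>\<^sub>\<infinity>f\<in>B. f x * cnj (f x)) = c" "c > 0"
  obtains A :: "nat \<Rightarrow> real" where
    "\<And>s. s \<ge> 0 \<Longrightarrow> (\<lambda>n. A n * s ^ n) sums (c * exp (\<alpha> * \<Phi> (of_real (sqrt s), 0)))"
proof -
  have f_hol: "holomorphic2 f" if "f \<in> B" for f
    using B that unfolding orthonormal_basis_def weighted_space_def by auto
  have kernel: "(\<lambda>f. (cmod (f x))\<^sup>2) summable_on B" "(\<Sum>\<^sub>\<infinity>f\<in>B. (cmod (f x))\<^sup>2) = c * exp (\<alpha> * \<Phi> x)" for x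
  proof -
    let ?S = "\<Sum>\<^sub>\<infinity>f\<in>B. complex_of_real ((cmod (f x))\<^sup>2)"
    have c': "exp (- \<alpha> * \<Phi> x) * Re ?S = c"
      using c(1)[of x] unfolding complex_norm_square .
    \<comment> \<open>An unconditional sum that does not exist has the value 0; positivity of \<open>c\<close> excludes this.\<close>
    then have "?S \<noteq> 0" using c(2) by auto
    then have "(\<lambda>f. complex_of_real ((cmod (f x))\<^sup>2)) summable_on B" using infsum_not_exists by blast
    then show sm: "(\<lambda>f. (cmod (f x))\<^sup>2) summable_on B"
      by (simp only: summable_on_iff_abs_summable_on_complex norm_of_real abs_power2)
    have "?S = of_real (\<Sum>\<^sub>\<infinity>f\<in>B. (cmod (f x))\<^sup>2)"
      by (rule infsumI, rule has_sum_of_real, rule has_sum_infsum[OF sm])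
    then show "(\<Sum>\<^sub>\<infinity>f\<in>B. (cmod (f x))\<^sup>2) = c * exp (\<alpha> * \<Phi> x)"
      using c' by (simp add: exp_minus field_simps)
  qed
  define B0 where "B0 = {f \<in> B. \<exists>z. f (z, 0) \<noteq> 0}"
  obtain D :: "complex set" where D: "countable D" "\<And>X. open X \<Longrightarrow> X \<noteq> {} \<Longrightarrow> \<exists>d\<in>D. d \<in> X"
    using countable_dense_setE by blast
  have "countable B0"
  proof (rule countable_subset)
    show "countable (\<Union>d\<in>D. {f \<in> B. (cmod (f (d, 0)))\<^sup>2 \<noteq> 0})"
      using D(1) kernel(1) by (intro countable_UN summable_countable_real) auto
    show "B0 \<subseteq> (\<Union>d\<in>D. {f \<in> B. (cmod (f (d, 0)))\<^sup>2 \<noteq> 0})"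
    proof
      fix f assume f: "f \<in> B0"
      have "open {z. f (z, 0) \<noteq> 0}"
        using f f_hol[of f] unfolding B0_def
        by (intro open_Collect_neq continuous_intros continuous_on_compose2[OF holomorphic2_continuous[of f UNIV]]) auto
      then obtain d where "d \<in> D" "f (d, 0) \<noteq> 0" using D(2)[of "{z. f (z, 0) \<noteq> 0}"] f unfolding B0_def by auto
      then show "f \<in> (\<Union>d\<in>D. {f \<in> B. (cmod (f (d, 0)))\<^sup>2 \<noteq> 0})" using f unfolding B0_def by auto
    qed
  qed
  define a where "a f n = (deriv ^^ n) (\<lambda>z. f (z, 0)) 0 / fact n" for f :: "c2 \<Rightarrow> complex" and n
  have a: "(\<lambda>n. a f n * z ^ n) sums f (z, 0)" if "f \<in> B0" for f z
    unfolding a_def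
    using entire_power_series[of "\<lambda>z. f (z, 0)"] holomorphic2_line[OF f_hol[of f], of 0 1 0 0 UNIV] that
    unfolding B0_def by simp
  have nn_kernel: "(\<integral>\<^sup>+f. ennreal ((cmod (f (z, 0)))\<^sup>2) \<partial>count_space B0) = ennreal (c * exp (\<alpha> * \<Phi> (z, 0)))" for z
  proof -
    have "(\<Sum>\<^sub>\<infinity>f\<in>B0. (cmod (f (z, 0)))\<^sup>2) = (\<Sum>\<^sub>\<infinity>f\<in>B. (cmod (f (z, 0)))\<^sup>2)"
      by (rule infsum_cong_neutral) (auto simp: B0_def)
    moreover have "(\<lambda>f. (cmod (f (z, 0)))\<^sup>2) summable_on B0"
      by (rule summable_on_subset_banach[OF kernel(1)]) (auto simp: B0_def)
    then have s: "Infinite_Set_Sum.abs_summable_on (\<lambda>f. (cmod (f (z, 0)))\<^sup>2) B0"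
      by (subst abs_summable_equivalent[symmetric]) simp
    ultimately show ?thesis
      using nn_integral_conv_infsetsum[OF s] infsetsum_infsum[OF s] kernel(2)[of "(z, 0)"] by simp
  qed
  define A where "A n = (\<integral>\<^sup>+f. ennreal ((cmod (a f n))\<^sup>2) \<partial>count_space B0)" for n
  have series: "ennreal (c * exp (\<alpha> * \<Phi> (z, 0))) = (\<Sum>n. A n * ennreal ((cmod (z ^ n))\<^sup>2))" for z
  proof -
    have inv: "\<Phi> (turn t * z, 0) = \<Phi> (z, 0)" for t
      using invariant[of "turn t" 1 "(z, 0)"] by (simp add: torus_act_def)
    have "ennreal (c * exp (\<alpha> * \<Phi> (z, 0))) = (\<integral>\<^sup>+t. \<integral>\<^sup>+f. ennreal ((cmod (f (turn t * z, 0)))\<^sup>2) \<partial>count_space B0 \<partial>circle)"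
      unfolding nn_kernel inv by simp
    also have "\<dots> = (\<integral>\<^sup>+f. \<integral>\<^sup>+t. ennreal ((cmod (f (turn t * z, 0)))\<^sup>2) \<partial>circle \<partial>count_space B0)"
    proof (rule nn_integral_count_space_nn_integral[OF \<open>countable B0\<close>])
      fix f assume "f \<in> B0"
      then have "holomorphic2 f" using f_hol unfolding B0_def by auto
      then have "(\<lambda>t. f (turn t * z, 0)) \<in> borel_measurable borel"
        by (intro borel_measurable_continuous_onI continuous_on_compose2[OF holomorphic2_continuous[of f UNIV]] continuous_intros) auto
      then show "(\<lambda>t. ennreal ((cmod (f (turn t * z, 0)))\<^sup>2)) \<in> borel_measurable circle" by measurable
    qed
    also have "\<dots> = (\<integral>\<^sup>+f. (\<Sum>n. ennreal ((cmod (a f n * z ^ n))\<^sup>2)) \<partial>count_space B0)"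
      using a by (intro nn_integral_cong parseval_entire) auto
    also have "\<dots> = (\<Sum>n. \<integral>\<^sup>+f. ennreal ((cmod (a f n * z ^ n))\<^sup>2) \<partial>count_space B0)"
      by (rule nn_integral_suminf) auto
    also have "\<dots> = (\<Sum>n. A n * ennreal ((cmod (z ^ n))\<^sup>2))"
      unfolding A_def by (simp add: norm_mult power_mult_distrib ennreal_mult nn_integral_multc)
    finally show ?thesis .
  qed
  \<comment> \<open>The term \<open>A n\<close> is bounded by the sum of the whole series at \<open>z = 1\<close>.\<close>
  have A_fin: "A n < \<infinity>" for n
  proof -
    have "A n = (\<Sum>n\<in>{n}. A n * ennreal ((cmod (1 ^ n))\<^sup>2))" by simp
    also have "\<dots> \<le> (\<Sum>n. A n * ennreal ((cmod (1 ^ n))\<^sup>2))" by (rule sum_le_suminf) auto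
    also have "\<dots> < \<infinity>" unfolding series[symmetric] by simp
    finally show ?thesis .
  qed
  show thesis
  proof
    fix s :: real assume s: "s \<ge> 0"
    let ?z = "complex_of_real (sqrt s)"
    have "A n * ennreal ((cmod (?z ^ n))\<^sup>2) = ennreal (enn2real (A n) * s ^ n)" for n
    proof -
      have "(cmod (?z ^ n))\<^sup>2 = s ^ n"
        using s by (simp add: norm_power power_mult[symmetric] mult.commute[of n]) (simp add: power_mult)
      then show ?thesis using A_fin[of n] s by (simp add: ennreal_mult)
    qed
    then have sum: "ennreal (c * exp (\<alpha> * \<Phi> (?z, 0))) = (\<Sum>n. ennreal (enn2real (A n) * s ^ n))"
      using series[of ?z] by simp
    have nn: "0 \<le> enn2real (A n) * s ^ n" for n using s by simp
    have "summable (\<lambda>n. enn2real (A n) * s ^ n)"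
      using sum nn by (intro summable_suminf_not_top) auto
    then show "(\<lambda>n. enn2real (A n) * s ^ n) sums (c * exp (\<alpha> * \<Phi> (?z, 0)))"
      using sum c(2) nn by (subst (asm) suminf_ennreal2) (auto simp: sums_iff suminf_nonneg)
  qed
qed

end

text \<open>By the identity theorem \<open>G (s z) = c e\<^bsup>\<alpha>(z + m z\<^sup>2)\<^esup>\<close> for all complex \<open>z\<close>, where \<open>s z = z e\<^sup>2\<^sup>m\<^sup>z\<close>. Both sides have
  a derivative divisible by \<open>1 + 2mz\<close>; dividing by it gives \<open>G' (s z) e\<^sup>2\<^sup>m\<^sup>z = \<alpha> G (s z)\<close>. At the zero
  \<open>z\<^sub>0 = -1/(2m)\<close> of \<open>s'\<close> the derivative of this relation reads \<open>2m e\<^sup>2\<^sup>m\<^sup>z G' (s z) = 0\<close>. So \<open>G'\<close> and then \<open>G\<close>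
  vanish at \<open>s z\<^sub>0\<close>, whereas \<open>c e\<^bsup>\<alpha>(z + m z\<^sup>2)\<^esup>\<close> has no zeros.\<close>

lemma lebrun_axis_not_entire:
  fixes G :: "complex \<Rightarrow> complex" and m \<alpha> c :: real
  assumes G: "G holomorphic_on UNIV" and pos: "m > 0" "\<alpha> > 0" "c > 0"
    and G_eq: "\<And>U. U \<ge> 0 \<Longrightarrow> G (of_real (U * exp (2 * m * U))) = of_real (c * exp (\<alpha> * (U + m * U\<^sup>2)))"
  shows False
proof -
  define M a C :: complex where "M = of_real m" and "a = of_real \<alpha>" and "C = of_real c"
  have M: "M \<noteq> 0" "a \<noteq> 0" "C \<noteq> 0" using pos unfolding M_def a_def C_def by auto
  define s where "s z = z * exp (2 * M * z)" for z
  have s_hol: "s holomorphic_on UNIV" unfolding s_def by (intro holomorphic_intros)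
  have ds: "(s has_field_derivative (1 + 2 * M * z) * exp (2 * M * z)) (at z)" for z
    unfolding s_def by (auto intro!: derivative_eq_intros simp: algebra_simps)
  have dG: "(G has_field_derivative deriv G z) (at z)" for z
    using G by (rule holomorphic_derivI) auto
  have G'_hol: "deriv G holomorphic_on UNIV" using G by (rule holomorphic_deriv) auto
  have dG': "(deriv G has_field_derivative deriv (deriv G) z) (at z)" for z
    using G'_hol by (rule holomorphic_derivI) auto
  have comp_hol: "(\<lambda>z. G (s z)) holomorphic_on UNIV" "(\<lambda>z. deriv G (s z)) holomorphic_on UNIV"
    using holomorphic_on_compose_gen[OF s_hol G] holomorphic_on_compose_gen[OF s_hol G'_hol]
    unfolding o_def by auto
  have Gs: "G (s z) = C * exp (a * (z + M * z\<^sup>2))" for z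
  proof -
    have "G (s z) - C * exp (a * (z + M * z\<^sup>2)) = 0"
    proof (rule analytic_continuation[of "\<lambda>z. G (s z) - C * exp (a * (z + M * z\<^sup>2))" UNIV "of_real ` {0<..}" 0])
      show "(\<lambda>z. G (s z) - C * exp (a * (z + M * z\<^sup>2))) holomorphic_on UNIV"
        by (intro holomorphic_intros comp_hol)
      show "0 islimpt complex_of_real ` {0<..}"
        unfolding islimpt_approachable
      proof (intro allI impI)
        fix e :: real assume "e > 0"
        then show "\<exists>x'\<in>complex_of_real ` {0<..}. x' \<noteq> 0 \<and> dist x' 0 < e"
          by (intro bexI[of _ "complex_of_real (e / 2)"] imageI) auto
      qed
      fix z assume "z \<in> complex_of_real ` {0<..}"
      then obtain U where U: "z = of_real U" "U \<ge> 0" by auto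
      have e1: "s z = of_real (U * exp (2 * m * U))" unfolding s_def U M_def by (simp add: exp_of_real[symmetric])
      have e2: "C * exp (a * (z + M * z\<^sup>2)) = of_real (c * exp (\<alpha> * (U + m * U\<^sup>2)))"
        unfolding U M_def a_def C_def by (simp add: exp_of_real[symmetric])
      show "G (s z) - C * exp (a * (z + M * z\<^sup>2)) = 0" unfolding e1 e2 G_eq[OF U(2)] by simp
    qed auto
    then show ?thesis by simp
  qed
  define z0 where "z0 = - 1 / (2 * M)"
  have z0: "1 + 2 * M * z = 0 \<longleftrightarrow> z = z0" for z
    unfolding z0_def using M by (auto simp: field_simps eq_neg_iff_add_eq_0)
  define H where "H z = deriv G (s z) * exp (2 * M * z) - a * G (s z)" for z
  have H0_off: "H z = 0" if "z \<noteq> z0" for z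
  proof -
    have "((\<lambda>z. G (s z)) has_field_derivative deriv G (s z) * ((1 + 2 * M * z) * exp (2 * M * z))) (at z)"
      by (rule DERIV_chain2[OF dG ds])
    moreover have "((\<lambda>z. G (s z)) has_field_derivative C * (exp (a * (z + M * z\<^sup>2)) * (a * (1 + 2 * M * z)))) (at z)"
      unfolding Gs by (auto intro!: derivative_eq_intros simp: algebra_simps)
    ultimately have "deriv G (s z) * ((1 + 2 * M * z) * exp (2 * M * z)) = C * (exp (a * (z + M * z\<^sup>2)) * (a * (1 + 2 * M * z)))"
      by (rule DERIV_unique)
    then have "(1 + 2 * M * z) * H z = 0" unfolding H_def Gs by (simp add: algebra_simps)
    then show ?thesis using z0[of z] that by simp
  qed
  have H_hol: "H holomorphic_on UNIV"
    unfolding H_def by (intro holomorphic_intros comp_hol)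
  have H0: "H z = 0" for z
  proof (rule analytic_continuation_open[of "- {z0}" UNIV H "\<lambda>_. 0"])
    have "z0 + 1 \<in> - {z0}" by simp
    then show "- {z0} \<noteq> {}" by blast
  qed (use H0_off H_hol in auto)
  have dH: "(H has_field_derivative 2 * M * exp (2 * M * z0) * deriv G (s z0)) (at z0)"
  proof -
    have "1 + 2 * M * z0 = 0" using z0 by simp
    then have "((\<lambda>z. G (s z)) has_field_derivative 0) (at z0)" "((\<lambda>z. deriv G (s z)) has_field_derivative 0) (at z0)"
      using DERIV_chain2[OF dG ds[of z0]] DERIV_chain2[OF dG' ds[of z0]] by simp_all
    then show ?thesis unfolding H_def by (auto intro!: derivative_eq_intros)
  qed
  have "H = (\<lambda>_. 0)" using H0 by auto
  then have "2 * M * exp (2 * M * z0) * deriv G (s z0) = 0"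
    using dH DERIV_unique[OF _ DERIV_const] by blast
  then have "deriv G (s z0) = 0" using M by simp
  then have "G (s z0) = 0" using H0[of z0] M unfolding H_def by simp
  then show False unfolding Gs using M by simp
qed

lemma torus_weight_lebrun:
  assumes "m \<ge> 0"
  shows "torus_weight (lebrun_potential m)"
proof
  show "volume_measure (lebrun_potential m) = lborel" using assms by (rule volume_measure_lebrun)
  show "continuous_on UNIV (lebrun_potential m)"
    unfolding lebrun_potential_eq[OF assms] by (intro continuous_intros continuous_on_gap2 assms)
  show "lebrun_potential m (torus_act l r p) = lebrun_potential m p" if "cmod l = 1" "cmod r = 1" for l r p
    using that unfolding lebrun_potential_eq[OF assms] torus_act_def by (simp add: norm_mult)
qed

text \<open>The coefficients of \<open>kernel_axis_entire\<close> define an entire function, since the series converges at all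
  positive reals.\<close>

lemma not_balanced_lebrun:
  assumes "m > 0" "\<alpha> > 0"
  shows "\<not> balanced \<alpha> (lebrun_potential m)"
proof
  let ?\<Phi> = "lebrun_potential m"
  assume "balanced \<alpha> ?\<Phi>"
  then obtain c where c: "c > 0" "\<And>x. epsilon_fun \<alpha> ?\<Phi> x = c" unfolding balanced_def by auto
  interpret torus_weight \<alpha> ?\<Phi> by (rule torus_weight_lebrun) (use assms in simp)
  have B: "orthonormal_basis \<alpha> ?\<Phi> (SOME B. orthonormal_basis \<alpha> ?\<Phi> B)"
    using ex_orthonormal_basis by (rule someI_ex)
  obtain A where A: "\<And>s. s \<ge> 0 \<Longrightarrow> (\<lambda>n. A n * s ^ n) sums (c * exp (\<alpha> * ?\<Phi> (of_real (sqrt s), 0)))"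
    using kernel_axis_entire[OF B c(2)[unfolded epsilon_fun_def weighted_kernel_def] c(1)] by blast
  define G where "G z = (\<Sum>n. complex_of_real (A n) * z ^ n)" for z
  have G: "(\<lambda>n. complex_of_real (A n) * z ^ n) sums G z" for z
  proof -
    have "summable (\<lambda>n. A n * (cmod z + 1) ^ n)" using A[of "cmod z + 1"] by (auto simp: sums_iff)
    then have "summable (\<lambda>n. complex_of_real (A n) * of_real (cmod z + 1) ^ n)"
      unfolding of_real_power[symmetric] of_real_mult[symmetric] by (rule summable_of_real)
    then have "summable (\<lambda>n. complex_of_real (A n) * z ^ n)" by (rule powser_inside) simp
    then show ?thesis unfolding G_def by (rule summable_sums)
  qed
  have "G holomorphic_on ball 0 r" for r
    by (rule power_series_holomorphic[where a = "\<lambda>n. of_real (A n)"]) (use G in simp)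
  then have "G holomorphic_on (\<Union>r. ball 0 r)" by (intro holomorphic_on_UN_open) auto
  moreover have "(\<Union>r. ball (0 :: complex) r) = UNIV" by (auto intro: gt_ex)
  ultimately have "G holomorphic_on UNIV" by simp
  moreover have "G (of_real (U * exp (2 * m * U))) = of_real (c * exp (\<alpha> * (U + m * U\<^sup>2)))" if "U \<ge> 0" for U
  proof -
    let ?s = "U * exp (2 * m * U)"
    have s: "?s \<ge> 0" using that by simp
    have "?\<Phi> (of_real (sqrt ?s), 0) = U + m * U\<^sup>2"
      by (rule lebrun_potential_axis) (use assms that s in auto)
    from A[OF s, unfolded this]
    have "(\<lambda>n. complex_of_real (A n * ?s ^ n)) sums of_real (c * exp (\<alpha> * (U + m * U\<^sup>2)))"
      by (rule sums_of_real)
    moreover have "(\<lambda>n. complex_of_real (A n * ?s ^ n)) sums G (of_real ?s)"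
      using G[of "of_real ?s"] unfolding of_real_power[symmetric] of_real_mult[symmetric] .
    ultimately show ?thesis by (rule sums_unique2[symmetric])
  qed
  ultimately show False using lebrun_axis_not_entire[of G m \<alpha> c] assms c(1) by blast
qed

lemma balanced_flat:
  assumes "\<alpha> > 0"
  shows "balanced \<alpha> (lebrun_potential 0)"
proof -
  interpret torus_weight \<alpha> "lebrun_potential 0" by (rule torus_weight_lebrun) simp
  interpret gaussian_weight \<alpha> "lebrun_potential 0"
  proof
    show "lebrun_potential 0 p = (norm p)\<^sup>2" for p
      by (cases p) (simp add: lebrun_potential_eq norm_Pair)
  qed (rule assms)
  show ?thesis by (rule balanced_gaussian[OF ex_orthonormal_basis])
qed

theorem theorem4:
  fixes m \<alpha> :: real
  assumes "m \<ge> 0" and "\<alpha> > 0"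
  shows "(balanced \<alpha> (lebrun_potential m) \<longleftrightarrow> m = 0) \<and>
         (m = 0 \<longleftrightarrow> lebrun_metric m = flat_metric)"
proof
  show "balanced \<alpha> (lebrun_potential m) \<longleftrightarrow> m = 0"
    using not_balanced_lebrun[of m \<alpha>] balanced_flat[of \<alpha>] assms by (cases "m = 0") auto
  show "m = 0 \<longleftrightarrow> lebrun_metric m = flat_metric"
    by (rule lebrun_metric_flat_iff[OF assms(1)])
qed

end
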